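(* Let $\varphi_1:\mathbb{R}^p\to\mathbb{R}$ be differentiable with $L_{\varphi_1}$-Lipschitz continuous gradient, $\varphi_2:\mathbb{R}^p\to\mathbb{R}\cup\{\infty\}$ lower semicontinuous, $\varphi=\varphi_1+\varphi_2$ with $\operatorname{argmin}\varphi\ne\emptyset$. Consider the (infinite) iterates generated by Algorithm 1 (defined in the context) with tolerance $\varepsilon=0$ and directions $d^k$ selected with the modified Broyden method (defined in the context). Suppose that the sequence of Broyden matrices $(H_k)_k$ is bounded, and that $(s^k)_k$ converges to a point $s_\star$ such that $u_\star:=\operatorname{prox}_{\gamma\varphi_1}(s_\star)$ is a strong local minimum of $\varphi$ and at which the residual mapping $R_\gamma$ is Lipschitz-semidifferentiable and has a nonsingular Jacobian $JR_\gamma(s_\star)$. Then the Dennis–Moré condition $$\lim_{k\to\infty}\frac{\|R_\gamma(s^k)+JR_\gamma(s_\star)d^k\|}{\|d^k\|}=0$$ holds, and in particular the unit stepsize $\tau_k=1$ is eventually always accepted and $(s^k)_k$ converges superlinearly.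
   Context: For $\gamma>0$, $\operatorname{prox}_{\gamma h}(x)=\operatorname{argmin}_w\{h(w)+\frac1{2\gamma}\|w-x\|^2\}$. The DRS oracle is $\mathrm{DRS}_\gamma(s)=\{(u,v): u\in\operatorname{prox}_{\gamma\varphi_1}(s),\ v\in\operatorname{prox}_{\gamma\varphi_2}(2u-s)\}$. For $0<\gamma<1/L_{\varphi_1}$, $\operatorname{prox}_{\gamma\varphi_1}$ is single valued and the Douglas–Rachford envelope $$\varphi_\gamma^{\rm DR}(s)=\varphi_1(u)+\varphi_2(v)+\tfrac1\gamma\langle s-u,v-u\rangle+\tfrac1{2\gamma}\|v-u\|^2,\quad (u,v)\in\mathrm{DRS}_\gamma(s),$$ is independent of the choice of $(u,v)$. The (possibly set-valued) residual is $R_\gamma(s)=\operatorname{prox}_{\gamma\varphi_1}(s)-\operatorname{prox}_{\gamma\varphi_2}(2\operatorname{prox}_{\gamma\varphi_1}(s)-s)$; where it is single valued, $R_\gamma(s^k)=r^k$. $u_\star\in\operatorname{dom}\varphi$ is a strong local minimum of $\varphi$ if for some $\mu>0$, $\varphi(u)\ge\varphi(u_\star)+\frac\mu2\|u-u_\star\|^2$ for all $u$ near $u_\star$. $R_\gamma$ is Lipschitz-semidifferentiable at $s_\star$ if it is single valued and semidifferentiable (locally Lipschitz and directionally differentiable) on a neighborhood $U$ of $s_\star$, with directional derivatives $DR_\gamma(s)[w]$ satisfying, for some $L>0$, $\|DR_\gamma(s)[w]-DR_\gamma(s_\star)[w]\|\le L\|s-s_\star\|\|w\|$ for all $s\in U$,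 $w\in\mathbb{R}^p$. Superlinear convergence of $s^k$ to $s_\star$: either $s^k=s_\star$ for some $k$ or $\|s^{k+1}-s_\star\|/\|s^k-s_\star\|\to0$. Constant: $C(\alpha,\lambda)=\frac{\lambda}{(1+\alpha)^2}\bigl(\frac{2-\lambda}{2}-\alpha\,m\bigr)$, where $m=\max\{\alpha-\frac\lambda2,0\}$ if $\varphi_1$ is convex and $m=1$ otherwise. Algorithm 1 (linesearch DRS). Inputs: $s^0\in\mathbb{R}^p$, tolerance $\varepsilon$, relaxation $\lambda\in(0,2)$, $i_{\max}\in\mathbb{N}\cup\{\infty\}$, stepsize $0<\gamma<1/L_{\varphi_1}$ if $\varphi_1$ is convex and $0<\gamma<\frac{2-\lambda}{2L_{\varphi_1}}$ otherwise, and $0<c<C(\gamma L_{\varphi_1},\lambda)$. Initialize $k=0$ and $(u^0,v^0)\in\mathrm{DRS}_\gamma(s^0)$. (1) $r^k=u^k-v^k$; if $\frac1\gamma\|r^k\|\le\varepsilon$, stop. (2) $\bar s^{k+1}=s^k-\lambda r^k$. (3) Select a direction $d^k\in\mathbb{R}^p$; set $\tau_k=1$, $i_k=0$. (4) $s^{k+1}=(1-\tau_k)\bar s^{k+1}+\tau_k(s^k+d^k)$. (5) Compute $(u^{k+1},v^{k+1})\in\mathrm{DRS}_\gamma(s^{k+1})$. (6) If $\varphi_\gamma^{\rm DR}(s^{k+1})\le\varphi_\gamma^{\rm DR}(s^k)-\frac c\gamma\|r^k\|^2$: $k\leftarrow k+1$ and go to (1) (the current $\tau_k$ is accepted). (7)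 Otherwise, if $i_k=i_{\max}$: set $s^{k+1}=\bar s^{k+1}$, $(u^{k+1},v^{k+1})\in\mathrm{DRS}_\gamma(s^{k+1})$, $k\leftarrow k+1$ and go to (1). (8) Otherwise: $\tau_k\leftarrow\tau_k/2$, $i_k\leftarrow i_k+1$ and go to (4). Modified Broyden directions: fix $\bar\vartheta\in(0,1)$ and an invertible matrix $H_0\in\mathbb{R}^{p\times p}$. At iteration $k$ let $d^k=-H_kr^k$, $p_k=d^k$, $q_k=r_0^{k+1}-r^k$, where $r_0^{k+1}=u_0^{k+1}-v_0^{k+1}$ with $(u_0^{k+1},v_0^{k+1})\in\mathrm{DRS}_\gamma(s^k+d^k)$ the pair computed in the first linesearch trial ($\tau_k=1$), and $$H_{k+1}=H_k+\frac{p_k-H_kq_k}{\langle p_k,(1/\vartheta_k-1)p_k+H_kq_k\rangle}\,p_k^\top H_k,$$ where $\delta_k=\frac{\langle H_kq_k,p_k\rangle}{\|p_k\|^2}$, $\vartheta_k=1$ if $|\delta_k|\ge\bar\vartheta$ and $\vartheta_k=\frac{1-\operatorname{sign}(\delta_k)\bar\vartheta}{1-\delta_k}$ if $|\delta_k|<\bar\vartheta$, with the convention $\operatorname{sign}0=1$. *)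

theory Defs
  imports "HOL-Analysis.Analysis"
begin

definition argmin :: "('a \<Rightarrow> ereal) \<Rightarrow> 'a set" where
  "argmin h = {x. is_arg_min h (\<lambda>_. True) x}"

definition lsc :: "('a::topological_space \<Rightarrow> ereal) \<Rightarrow> bool" where
  "lsc h \<longleftrightarrow> (\<forall>x. h x \<le> Liminf (nhds x) h)"

definition lipschitz_gradient :: "real \<Rightarrow> ('a::real_inner \<Rightarrow> real) \<Rightarrow> bool" where
  "lipschitz_gradient L f \<longleftrightarrow> (\<exists>g. (\<forall>x. GDERIV f x :> g x) \<and> L-lipschitz_on UNIV g)"

definition strong_local_min :: "('a::real_normed_vector \<Rightarrow> ereal) \<Rightarrow> 'a \<Rightarrow> bool" where
  "strong_local_min h x \<longleftrightarrow> \<bar>h x\<bar> \<noteq> \<infinity> \<and>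
     (\<exists>\<mu>>0. \<forall>\<^sub>F y in nhds x. h y \<ge> h x + ereal (\<mu> / 2 * (norm (y - x))\<^sup>2))"

definition superlinear_conv :: "(nat \<Rightarrow> 'a::real_normed_vector) \<Rightarrow> 'a \<Rightarrow> bool" where
  "superlinear_conv x x_star \<longleftrightarrow> (\<exists>k. x k = x_star) \<or>
     (\<lambda>k. norm (x (Suc k) - x_star) / norm (x k - x_star)) \<longlonglongrightarrow> 0"

definition semidifferentiable_on ::
  "('a::real_normed_vector \<Rightarrow> 'b::real_normed_vector) \<Rightarrow> ('a \<Rightarrow> 'a \<Rightarrow> 'b) \<Rightarrow> 'a set \<Rightarrow> bool" where
  "semidifferentiable_on f Df U \<longleftrightarrow>
     (\<forall>x\<in>U. \<exists>e>0. \<exists>K. K-lipschitz_on (ball x e \<inter> U) f) \<and>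
     (\<forall>x\<in>U. \<forall>w. ((\<lambda>t::real. (f (x + t *\<^sub>R w) - f x) /\<^sub>R t) \<longlongrightarrow> Df x w) (at_right 0))"

text \<open>A set-valued map \<open>F\<close> is read as the function \<open>the_elem \<circ> F\<close> wherever it is single valued.\<close>

definition lipschitz_semidifferentiable_at ::
  "('a::real_normed_vector \<Rightarrow> 'b::real_normed_vector set) \<Rightarrow> 'a \<Rightarrow> bool" where
  "lipschitz_semidifferentiable_at F x0 \<longleftrightarrow>
     (\<exists>U DF. open U \<and> x0 \<in> U \<and> (\<forall>x\<in>U. is_singleton (F x)) \<and>
        semidifferentiable_on (the_elem \<circ> F) DF U \<and>
        (\<exists>L>0. \<forall>x\<in>U. \<forall>w. norm (DF x w - DF x0 w) \<le> L * norm (x - x0) * norm w))"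


subsection \<open>Douglas--Rachford splitting\<close>

definition prox :: "real \<Rightarrow> ('a::real_normed_vector \<Rightarrow> ereal) \<Rightarrow> 'a \<Rightarrow> 'a set" where
  "prox \<gamma> h x = argmin (\<lambda>w. h w + ereal (1 / (2 * \<gamma>) * (norm (w - x))\<^sup>2))"

definition DRS :: "real \<Rightarrow> ('a::real_inner \<Rightarrow> real) \<Rightarrow> ('a \<Rightarrow> ereal) \<Rightarrow> 'a \<Rightarrow> ('a \<times> 'a) set" where
  "DRS \<gamma> \<phi>1 \<phi>2 s = {(u, v). u \<in> prox \<gamma> (\<lambda>x. ereal (\<phi>1 x)) s \<and> v \<in> prox \<gamma> \<phi>2 (2 *\<^sub>R u - s)}"

definition DRE_value ::
  "real \<Rightarrow> ('a::real_inner \<Rightarrow> real) \<Rightarrow> ('a \<Rightarrow> ereal) \<Rightarrow> 'a \<Rightarrow> 'a \<times> 'a \<Rightarrow> ereal" where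
  "DRE_value \<gamma> \<phi>1 \<phi>2 s = (\<lambda>(u, v). ereal (\<phi>1 u) + \<phi>2 v
     + ereal (1 / \<gamma> * inner (s - u) (v - u) + 1 / (2 * \<gamma>) * (norm (v - u))\<^sup>2))"

text \<open>For \<open>\<gamma> * L < 1\<close> all pairs in \<open>DRS \<gamma> \<phi>1 \<phi>2 s\<close> yield the same value, so the image below is a
  singleton.\<close>

definition DRE :: "real \<Rightarrow> ('a::real_inner \<Rightarrow> real) \<Rightarrow> ('a \<Rightarrow> ereal) \<Rightarrow> 'a \<Rightarrow> ereal" where
  "DRE \<gamma> \<phi>1 \<phi>2 s = the_elem (DRE_value \<gamma> \<phi>1 \<phi>2 s ` DRS \<gamma> \<phi>1 \<phi>2 s)"

definition residual :: "real \<Rightarrow> ('a::real_inner \<Rightarrow> real) \<Rightarrow> ('a \<Rightarrow> ereal) \<Rightarrow> 'a \<Rightarrow> 'a set" where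
  "residual \<gamma> \<phi>1 \<phi>2 s = {u - v | u v. (u, v) \<in> DRS \<gamma> \<phi>1 \<phi>2 s}"


subsection \<open>The linesearch algorithm\<close>

definition C_const :: "('a::real_vector \<Rightarrow> real) \<Rightarrow> real \<Rightarrow> real \<Rightarrow> real" where
  "C_const \<phi>1 \<alpha> relax =
     (let m = (if convex_on UNIV \<phi>1 then max (\<alpha> - relax / 2) 0 else 1)
      in relax / (1 + \<alpha>)\<^sup>2 * ((2 - relax) / 2 - \<alpha> * m))"

text \<open>The bounds \<open>\<gamma> < 1 / L\<close> and \<open>\<gamma> < (2 - relax) / (2 * L)\<close> are multiplied out, so that \<open>L = 0\<close>
  imposes no upper bound on \<open>\<gamma>\<close>.\<close>

definition admissible_params ::
  "('a::real_vector \<Rightarrow> real) \<Rightarrow> real \<Rightarrow> real \<Rightarrow> real \<Rightarrow> real \<Rightarrow> bool" where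
  "admissible_params \<phi>1 L \<gamma> relax c \<longleftrightarrow>
     0 < relax \<and> relax < 2 \<and> 0 < \<gamma> \<and>
     (if convex_on UNIV \<phi>1 then \<gamma> * L < 1 else \<gamma> * (2 * L) < 2 - relax) \<and>
     0 < c \<and> c < C_const \<phi>1 (\<gamma> * L) relax"

definition trial_point :: "real \<Rightarrow> 'a::real_vector \<Rightarrow> 'a \<Rightarrow> 'a \<Rightarrow> real \<Rightarrow> 'a" where
  "trial_point relax s r d \<tau> = (1 - \<tau>) *\<^sub>R (s - relax *\<^sub>R r) + \<tau> *\<^sub>R (s + d)"

definition sufficient_decrease ::
  "real \<Rightarrow> ('a::real_inner \<Rightarrow> real) \<Rightarrow> ('a \<Rightarrow> ereal) \<Rightarrow> real \<Rightarrow> 'a \<Rightarrow> 'a \<Rightarrow> 'a \<Rightarrow> bool" where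
  "sufficient_decrease \<gamma> \<phi>1 \<phi>2 c s r s' \<longleftrightarrow>
     DRE \<gamma> \<phi>1 \<phi>2 s' \<le> DRE \<gamma> \<phi>1 \<phi>2 s - ereal (c / \<gamma> * (norm r)\<^sup>2)"

text \<open>An infinite run: the stopping test never succeeds and every linesearch terminates.
  \<open>ls k\<close> and \<open>\<tau> k\<close> are the values of the backtracking counter and of the stepsize when the linesearch
  of iteration \<open>k\<close> ends; \<open>(ut k i, vt k i)\<close> is the pair computed in its trial \<open>i\<close>, which
  uses the stepsize \<open>(1/2)^i\<close> and is relevant for \<open>i \<le> ls k\<close> only.\<close>

definition linesearch_DRS_run ::
  "('a::real_inner \<Rightarrow> real) \<Rightarrow> ('a \<Rightarrow> ereal) \<Rightarrow> real \<Rightarrow> real \<Rightarrow> real \<Rightarrow> real \<Rightarrow> enat \<Rightarrow>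
   (nat \<Rightarrow> 'a) \<Rightarrow> (nat \<Rightarrow> 'a) \<Rightarrow> (nat \<Rightarrow> 'a) \<Rightarrow> (nat \<Rightarrow> 'a) \<Rightarrow> (nat \<Rightarrow> 'a) \<Rightarrow> (nat \<Rightarrow> real) \<Rightarrow>
   (nat \<Rightarrow> nat) \<Rightarrow> (nat \<Rightarrow> nat \<Rightarrow> 'a) \<Rightarrow> (nat \<Rightarrow> nat \<Rightarrow> 'a) \<Rightarrow> bool" where
  "linesearch_DRS_run \<phi>1 \<phi>2 \<gamma> relax c \<epsilon> i_max s u v r d \<tau> ls ut vt \<longleftrightarrow>
     (u 0, v 0) \<in> DRS \<gamma> \<phi>1 \<phi>2 (s 0) \<and>
     (\<forall>k. r k = u k - v k \<and> \<not> 1 / \<gamma> * norm (r k) \<le> \<epsilon> \<and> \<tau> k = (1/2) ^ ls k \<and>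
       (let trial = (\<lambda>i. trial_point relax (s k) (r k) (d k) ((1/2) ^ i));
            ok = (\<lambda>i. sufficient_decrease \<gamma> \<phi>1 \<phi>2 c (s k) (r k) (trial i))
        in (\<forall>i\<le>ls k. (ut k i, vt k i) \<in> DRS \<gamma> \<phi>1 \<phi>2 (trial i)) \<and>
           (\<forall>i<ls k. \<not> ok i \<and> enat i \<noteq> i_max) \<and>
           (if ok (ls k)
            then s (Suc k) = trial (ls k) \<and> u (Suc k) = ut k (ls k) \<and> v (Suc k) = vt k (ls k)
            else enat (ls k) = i_max \<and> s (Suc k) = s k - relax *\<^sub>R r k \<and>
                 (u (Suc k), v (Suc k)) \<in> DRS \<gamma> \<phi>1 \<phi>2 (s (Suc k)))))"


subsection \<open>Modified Broyden directions\<close>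

definition outer_product :: "real^'n \<Rightarrow> real^'m \<Rightarrow> real^'m^'n" where
  "outer_product a b = (\<chi> i j. a $ i * b $ j)"

text \<open>The convention here is that the sign of \<open>0\<close> is \<open>1\<close>, unlike for \<^const>\<open>sgn\<close>.\<close>

definition broyden_theta :: "real \<Rightarrow> real \<Rightarrow> real" where
  "broyden_theta \<theta>_bar \<delta> =
     (if \<bar>\<delta>\<bar> \<ge> \<theta>_bar then 1 else (1 - (if \<delta> \<ge> 0 then 1 else - 1) * \<theta>_bar) / (1 - \<delta>))"

definition broyden_update :: "real \<Rightarrow> real^'n^'n \<Rightarrow> real^'n \<Rightarrow> real^'n \<Rightarrow> real^'n^'n" where
  "broyden_update \<theta>_bar H p q =
     (let \<delta> = inner (H *v q) p / (norm p)\<^sup>2;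
          \<theta> = broyden_theta \<theta>_bar \<delta>
      in H + (1 / inner p ((1 / \<theta> - 1) *\<^sub>R p + H *v q)) *\<^sub>R outer_product (p - H *v q) (p v* H))"

text \<open>\<open>r0 k\<close> is the residual of the pair computed at \<open>s k + d k\<close> in the first trial of
  iteration \<open>k\<close>.\<close>

definition modified_broyden ::
  "real \<Rightarrow> real^'n^'n \<Rightarrow> (nat \<Rightarrow> real^'n^'n) \<Rightarrow> (nat \<Rightarrow> real^'n) \<Rightarrow> (nat \<Rightarrow> real^'n) \<Rightarrow>
   (nat \<Rightarrow> real^'n) \<Rightarrow> bool" where
  "modified_broyden \<theta>_bar H0 H r r0 d \<longleftrightarrow>
     H 0 = H0 \<and>
     (\<forall>k. d k = - (H k *v r k) \<and> H (Suc k) = broyden_update \<theta>_bar (H k) (d k) (r0 k - r k))"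

end

theory Submission
  imports Defs
begin

text \<open>
  The proof follows the classical scheme for quasi-Newton methods: a bounded deterioration estimate for the
  Broyden matrices gives the Dennis--More condition, this makes the undamped trial point superlinearly close
  to \<open>s_star\<close>, and superlinearly close trial points pass the linesearch test. The Douglas--Rachford envelope
  is the Lyapunov function behind the first and the last step.

  \<^bold>\<open>Square summable residuals.\<close> The envelope is bounded below and decreases in every iteration by a multiple of
  the squared residual: either the linesearch test says so, or the run falls back to the relaxed step, for which
  it is \<open>nominal_step_decrease\<close>. So the squared residuals have a finite sum
  (\<open>linesearch_run_residuals_square_summable\<close>). In particular \<open>s_star\<close> is a zero of the residual map \<open>R\<close>, and
  since the Jacobian \<open>J\<close> of \<open>R\<close> at \<open>s_star\<close> is nonsingular, the distance of \<open>s k\<close> from \<open>s_star\<close> is of the order of the residual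
  \<open>r k\<close>. Boundedness of the matrices bounds \<open>d k\<close> by a multiple of \<open>r k\<close> as well.

  \<^bold>\<open>Dennis--More condition.\<close> Lipschitz semidifferentiability makes the defect of linearization
  \<open>R (s k + d k) - R (s k) - J *v d k\<close>, relative to \<open>d k\<close>, of the order of \<open>r k\<close>
  (\<open>strict_differentiability_estimate\<close>), hence square summable. Let \<open>B k\<close> be the inverse of \<open>H k\<close>. The damped Broyden
  update changes \<open>B k - J\<close> by a rank-one matrix that removes a fixed fraction of the squared error along \<open>d k\<close> from the squared
  Frobenius norm, up to a multiple of the squared relative defect (\<open>rank_one_correction_error\<close>). Telescoping shows
  that the relative errors along \<open>d k\<close> tend to zero, and these are the quotients of the
  Dennis--More condition (\<open>modified_broyden_dennis_more\<close>).

  \<^bold>\<open>Unit stepsize and rate.\<close> The Dennis--More condition and the linearization estimate make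
  \<open>R (s k + d k)\<close>, and with it the distance of \<open>s k + d k\<close> from \<open>s_star\<close>, small compared with \<open>r k\<close>. Near \<open>s_star\<close> the envelope is
  bounded above by \<open>\<phi> us\<close>, the value of \<open>\<phi> = \<phi>1 + \<phi>2\<close> at the local minimizer \<open>us\<close>, plus a multiple of the squared distance from \<open>s_star\<close>,
  and bounded below by \<open>\<phi> us\<close> plus \<open>(1 - \<gamma> * L) / (2 * \<gamma>)\<close> times the squared residual. As the constant \<open>c\<close> of the
  test is smaller than \<open>(1 - \<gamma> * L) / 2\<close> (\<open>C_const_le_half\<close>), the trial point is accepted
  (\<open>superlinear_trial_sufficient_decrease\<close>), so that eventually \<open>s (Suc k) = s k + d k\<close>.
\<close>

section \<open>Functions with Lipschitz continuous gradient\<close>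

text \<open>The chain rule along a line; it reduces the estimates below to functions of one real variable.\<close>

lemma GDERIV_along_segment:
  fixes f :: "'a::real_inner \<Rightarrow> real"
  assumes "\<And>x. GDERIV f x :> g x"
  shows "((\<lambda>t. f (x + t *\<^sub>R e)) has_real_derivative inner (g (x + t *\<^sub>R e)) e) (at t)"
proof -
  have "((\<lambda>t. f (x + t *\<^sub>R e)) has_derivative (\<lambda>h. inner (h *\<^sub>R e) (g (x + t *\<^sub>R e)))) (at t)"
    by (rule has_derivative_compose[where f = "\<lambda>t. x + t *\<^sub>R e" and g = f])
      (use assms[unfolded gderiv_def] in \<open>auto intro!: derivative_eq_intros\<close>)
  then show ?thesis
    by (simp add: has_field_derivative_def inner_commute mult_commute_abs)
qed

text \<open>After subtraction of the quadratic upper model, the derivative along the segment from \<open>x\<close> to \<open>y\<close> is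
  nonpositive by the Lipschitz estimate.\<close>

lemma descent_lemma:
  fixes f :: "'a::real_inner \<Rightarrow> real"
  assumes grad: "\<And>x. GDERIV f x :> g x" and lip: "L-lipschitz_on UNIV g"
  shows "f y \<le> f x + inner (g x) (y - x) + L / 2 * (norm (y - x))\<^sup>2"
proof -
  define e where "e = y - x"
  define \<psi> where "\<psi> t = f (x + t *\<^sub>R e) - t * inner (g x) e - L / 2 * t\<^sup>2 * (norm e)\<^sup>2" for t
  have "\<psi> 1 \<le> \<psi> 0"
  proof (rule DERIV_nonpos_imp_nonincreasing[where f = \<psi> and a = 0 and b = 1])
    fix t :: real assume t: "0 \<le> t" and "t \<le> 1"
    have "(\<psi> has_real_derivative inner (g (x + t *\<^sub>R e)) e - inner (g x) e - L * t * (norm e)\<^sup>2) (at t)"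
      unfolding \<psi>_def by (auto intro!: derivative_eq_intros GDERIV_along_segment[OF grad])
    moreover have "inner (g (x + t *\<^sub>R e)) e - inner (g x) e \<le> L * t * (norm e)\<^sup>2"
    proof -
      have "inner (g (x + t *\<^sub>R e)) e - inner (g x) e \<le> norm (g (x + t *\<^sub>R e) - g x) * norm e"
        by (metis inner_diff_left norm_cauchy_schwarz)
      also have "norm (g (x + t *\<^sub>R e) - g x) \<le> L * (t * norm e)"
        using lipschitz_onD[OF lip, of "x + t *\<^sub>R e" x] t by (simp add: dist_norm)
      finally show ?thesis
        by (simp add: power2_eq_square mult_right_mono mult.assoc)
    qed
    ultimately show "\<exists>y. (\<psi> has_real_derivative y) (at t) \<and> y \<le> 0"
      by (intro exI[of _ "inner (g (x + t *\<^sub>R e)) e - inner (g x) e - L * t * (norm e)\<^sup>2"]) simp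
  qed simp
  then show ?thesis by (simp add: \<psi>_def e_def)
qed

lemma convex_above_tangent:
  fixes f :: "'a::real_inner \<Rightarrow> real"
  assumes grad: "\<And>x. GDERIV f x :> g x" and cvx: "convex_on UNIV f"
  shows "f x + inner (g x) (y - x) \<le> f y"
proof -
  let ?h = "\<lambda>t. f (x + t *\<^sub>R (y - x))"
  have "convex_on UNIV ?h"
  proof (rule convex_onI)
    fix t a b :: real assume t: "0 < t" "t < 1"
    have "x + ((1 - t) *\<^sub>R a + t *\<^sub>R b) *\<^sub>R (y - x)
        = (1 - t) *\<^sub>R (x + a *\<^sub>R (y - x)) + t *\<^sub>R (x + b *\<^sub>R (y - x))"
      by (simp add: algebra_simps)
    then show "?h ((1 - t) *\<^sub>R a + t *\<^sub>R b) \<le> (1 - t) * ?h a + t * ?h b"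
      using convex_onD[OF cvx, of t "x + a *\<^sub>R (y - x)" "x + b *\<^sub>R (y - x)"] t by simp
  qed simp
  moreover have "(?h has_real_derivative inner (g x) (y - x)) (at 0)"
    using GDERIV_along_segment[OF grad, of x "y - x" 0] by simp
  ultimately have "inner (g x) (y - x) * (1 - 0) \<le> ?h 1 - ?h 0"
    by (intro convex_on_imp_above_tangent[where A = UNIV]) simp_all
  then show ?thesis by simp
qed

text \<open>The inequality of Baillon and Haddad. The tangent inequality at \<open>x\<close> and the descent lemma at \<open>y\<close>
  are compared at the point that one gradient step of length \<open>1 / L\<close> on the tilted function
  \<open>z \<mapsto> f z - inner (g x) z\<close> reaches from \<open>y\<close>. The constant is multiplied out, so that \<open>L = 0\<close> is
  covered.\<close>

lemma convex_gradient_cocoercive: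
  fixes f :: "'a::real_inner \<Rightarrow> real"
  assumes grad: "\<And>x. GDERIV f x :> g x" and lip: "L-lipschitz_on UNIV g"
    and cvx: "convex_on UNIV f"
  shows "(norm (g y - g x))\<^sup>2 \<le> 2 * L * (f y - f x - inner (g x) (y - x))"
proof (cases "L = 0")
  case True
  then show ?thesis using lipschitz_onD[OF lip, of y x] by (simp add: dist_norm)
next
  case False
  then have L: "L > 0" using lipschitz_on_nonneg[OF lip] by simp
  define w where "w = g y - g x"
  define z where "z = y - (1 / L) *\<^sub>R w"
  have zy: "z - y = - ((1 / L) *\<^sub>R w)" by (simp add: z_def)
  have "f x + inner (g x) (z - x) \<le> f z" by (rule convex_above_tangent[OF grad cvx])
  also have "f z \<le> f y + inner (g y) (z - y) + L / 2 * (norm (z - y))\<^sup>2"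
    by (rule descent_lemma[OF grad lip])
  finally have "0 \<le> f y - f x - inner (g x) (y - x) + (inner w (z - y) + L / 2 * (norm (z - y))\<^sup>2)"
    by (simp add: w_def inner_diff_left inner_diff_right)
  also have "inner w (z - y) + L / 2 * (norm (z - y))\<^sup>2 = - (norm w)\<^sup>2 / (2 * L)"
    unfolding zy using L by (simp add: power2_norm_eq_inner power_divide) (simp add: field_simps power2_eq_square)
  finally show ?thesis using L by (simp add: w_def field_simps)
qed

section \<open>Proximal points and the Douglas--Rachford envelope\<close>

lemma argmin_iff: "x \<in> argmin h \<longleftrightarrow> (\<forall>y. h x \<le> h y)"
  by (simp add: argmin_def is_arg_min_linorder)

text \<open>The standing assumptions on the smooth term and the stepsize. The bound \<open>\<gamma> * L < 1\<close> makes
  \<open>u \<mapsto> u + \<gamma> *\<^sub>R grad u\<close> strongly monotone, and the proximal map of \<open>\<phi>1\<close> is contained in its inverse.\<close>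

locale smooth_prox =
  fixes \<phi>1 :: "'a::real_inner \<Rightarrow> real" and grad :: "'a \<Rightarrow> 'a" and L \<gamma> :: real
  assumes GDERIV_grad: "GDERIV \<phi>1 x :> grad x" and lipschitz_grad: "L-lipschitz_on UNIV grad"
    and \<gamma>_pos: "0 < \<gamma>" and \<gamma>L: "\<gamma> * L < 1"
begin

lemma L_nonneg: "0 \<le> L"
  using lipschitz_grad by (rule lipschitz_on_nonneg)

lemma prox_stationary:
  assumes "u \<in> prox \<gamma> (\<lambda>x. ereal (\<phi>1 x)) s"
  shows "s - u = \<gamma> *\<^sub>R grad u"
proof -
  define h where "h w = \<phi>1 w + 1 / (2 * \<gamma>) * (norm (w - s))\<^sup>2" for w
  have min: "h u \<le> h w" for w using assms by (simp add: prox_def argmin_iff h_def)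
  have "(h has_derivative (\<lambda>k. inner k (grad u) + 1 / (2 * \<gamma>) * (2 * inner k (u - s)))) (at u)"
    unfolding h_def power2_norm_eq_inner
    by (rule has_derivative_add[OF GDERIV_grad[unfolded gderiv_def]])
      (use \<gamma>_pos in \<open>auto intro!: derivative_eq_intros simp: inner_commute\<close>)
  then have "(h has_derivative (\<lambda>k. inner k (grad u + (1 / \<gamma>) *\<^sub>R (u - s)))) (at u)"
    by (simp add: inner_add_right)
  from differential_zero_maxmin[OF UNIV_I open_UNIV this] min
  have "inner k (grad u + (1 / \<gamma>) *\<^sub>R (u - s)) = 0" for k by metis
  then have "grad u + (1 / \<gamma>) *\<^sub>R (u - s) = 0" by (metis inner_eq_zero_iff)
  then have "\<gamma> *\<^sub>R (grad u + (1 / \<gamma>) *\<^sub>R (u - s)) = 0" by simp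
  then show ?thesis using \<gamma>_pos by (simp add: scaleR_add_right algebra_simps)
qed

lemma grad_displacement: "norm (\<gamma> *\<^sub>R grad u - \<gamma> *\<^sub>R grad u') \<le> \<gamma> * L * norm (u - u')"
  using lipschitz_onD[OF lipschitz_grad, of u u'] \<gamma>_pos
  by (simp add: dist_norm flip: scaleR_diff_right)

text \<open>By stationarity \<open>s = u + \<gamma> *\<^sub>R grad u\<close>, a perturbation of the identity by a map with Lipschitz constant
  \<open>\<gamma> * L < 1\<close>.\<close>

lemma prox_lipschitz:
  assumes "u \<in> prox \<gamma> (\<lambda>x. ereal (\<phi>1 x)) s" "u' \<in> prox \<gamma> (\<lambda>x. ereal (\<phi>1 x)) s'"
  shows "(1 - \<gamma> * L) * norm (u - u') \<le> norm (s - s')"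
proof -
  have "u - u' = (s - s') - (\<gamma> *\<^sub>R grad u - \<gamma> *\<^sub>R grad u')"
    using assms[THEN prox_stationary] by (simp add: algebra_simps)
  then have "norm (u - u') \<le> norm (s - s') + norm (\<gamma> *\<^sub>R grad u - \<gamma> *\<^sub>R grad u')"
    by (metis norm_triangle_ineq4)
  with grad_displacement[of u u'] show ?thesis by (simp add: algebra_simps)
qed

lemma prox_unique:
  assumes "u \<in> prox \<gamma> (\<lambda>x. ereal (\<phi>1 x)) s" "u' \<in> prox \<gamma> (\<lambda>x. ereal (\<phi>1 x)) s"
  shows "u = u'"
  using prox_lipschitz[OF assms] \<gamma>L by (simp add: mult_le_0_iff)

text \<open>The forward-backward model of \<open>\<phi>1 + \<phi>2\<close> at \<open>u\<close>: \<open>\<phi>1\<close> is linearized at \<open>u\<close> and a proximal term is added.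
  For \<open>u\<close> in the proximal set of \<open>\<phi>1\<close> at \<open>s\<close>, the Douglas--Rachford envelope at \<open>s\<close> is the minimum of this
  model over \<open>w\<close>; bounds on the envelope then follow from evaluating the model at well chosen points.\<close>

definition fb_model :: "('a \<Rightarrow> ereal) \<Rightarrow> 'a \<Rightarrow> 'a \<Rightarrow> ereal" where
  "fb_model \<phi>2 u w =
     \<phi>2 w + ereal (\<phi>1 u + inner (grad u) (w - u) + 1 / (2 * \<gamma>) * (norm (w - u))\<^sup>2)"

text \<open>Stationarity turns \<open>w - (2 *\<^sub>R u - s)\<close> into \<open>(w - u) + \<gamma> *\<^sub>R grad u\<close>. Completing the square shows that the
  model and the objective of the second proximal step differ by a constant, hence have the same
  minimizers.\<close>

lemma prox_objective_eq:
  assumes "u \<in> prox \<gamma> (\<lambda>x. ereal (\<phi>1 x)) s"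
  shows "fb_model \<phi>2 u w = \<phi>2 w + ereal (1 / (2 * \<gamma>) * (norm (w - (2 *\<^sub>R u - s)))\<^sup>2)
     + ereal (\<phi>1 u - \<gamma> / 2 * (norm (grad u))\<^sup>2)"
proof -
  have s: "w - (2 *\<^sub>R u - s) = (w - u) + \<gamma> *\<^sub>R grad u"
    using prox_stationary[OF assms] by (simp add: scaleR_2 algebra_simps)
  have "\<phi>1 u + inner (grad u) (w - u) + 1 / (2 * \<gamma>) * (norm (w - u))\<^sup>2
     = 1 / (2 * \<gamma>) * (norm (w - (2 *\<^sub>R u - s)))\<^sup>2 + (\<phi>1 u - \<gamma> / 2 * (norm (grad u))\<^sup>2)"
    unfolding s power2_norm_eq_inner inner_add_left inner_add_right inner_scaleR_left inner_scaleR_right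
    using \<gamma>_pos by (simp add: inner_commute field_simps power2_eq_square)
  then show ?thesis unfolding fb_model_def by (simp only: add.assoc plus_ereal.simps)
qed

lemma DRS_minimizes_fb_model:
  assumes "(u, v) \<in> DRS \<gamma> \<phi>1 \<phi>2 s"
  shows "fb_model \<phi>2 u v \<le> fb_model \<phi>2 u w"
proof -
  from assms have u: "u \<in> prox \<gamma> (\<lambda>x. ereal (\<phi>1 x)) s" by (simp add: DRS_def)
  show ?thesis unfolding prox_objective_eq[OF u]
    using assms by (intro add_right_mono) (simp add: DRS_def prox_def argmin_iff)
qed

text \<open>Here \<open>u\<close> is unique and all admissible \<open>v\<close> minimize the same model, so the envelope does not depend on
  the chosen pair.\<close>

lemma DRE_eq_fb_model:
  assumes "(u, v) \<in> DRS \<gamma> \<phi>1 \<phi>2 s"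
  shows "DRE \<gamma> \<phi>1 \<phi>2 s = fb_model \<phi>2 u v"
proof -
  have val: "DRE_value \<gamma> \<phi>1 \<phi>2 s (u', v') = fb_model \<phi>2 u' v'"
    if "(u', v') \<in> DRS \<gamma> \<phi>1 \<phi>2 s" for u' v'
  proof -
    have "s - u' = \<gamma> *\<^sub>R grad u'" using that prox_stationary by (auto simp: DRS_def)
    then show ?thesis using \<gamma>_pos
      by (cases "\<phi>2 v'") (simp_all add: DRE_value_def fb_model_def)
  qed
  have "DRE_value \<gamma> \<phi>1 \<phi>2 s ` DRS \<gamma> \<phi>1 \<phi>2 s = {fb_model \<phi>2 u v}"
  proof (intro set_eqI iffI)
    fix a assume "a \<in> DRE_value \<gamma> \<phi>1 \<phi>2 s ` DRS \<gamma> \<phi>1 \<phi>2 s"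
    then obtain u' v' where p: "(u', v') \<in> DRS \<gamma> \<phi>1 \<phi>2 s" and a: "a = fb_model \<phi>2 u' v'"
      using val by auto
    have "u' = u" using p assms prox_unique by (auto simp: DRS_def)
    then show "a \<in> {fb_model \<phi>2 u v}"
      using a DRS_minimizes_fb_model[OF assms, of v'] DRS_minimizes_fb_model[OF p, of v] by simp
  qed (use val[OF assms] assms in force)
  then show ?thesis by (simp add: DRE_def)
qed

lemma DRS_finite:
  assumes "(u, v) \<in> DRS \<gamma> \<phi>1 \<phi>2 s" "\<And>x. \<phi>2 x \<noteq> -\<infinity>" "\<phi>2 w \<noteq> \<infinity>"
  obtains b where "\<phi>2 v = ereal b"
proof (cases "\<phi>2 v")
  case PInf
  then show ?thesis
    using DRS_minimizes_fb_model[OF assms(1), of w] assms(2)[of w] assms(3)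
    by (cases "\<phi>2 w") (auto simp: fb_model_def)
qed (use assms in auto)

text \<open>The descent lemma leaves a margin: the curvature \<open>1 / \<gamma>\<close> of the proximal term exceeds \<open>L\<close>.\<close>

lemma DRE_lower_bound:
  assumes "(u, v) \<in> DRS \<gamma> \<phi>1 \<phi>2 s"
  shows "ereal (\<phi>1 v) + \<phi>2 v + ereal ((1 - \<gamma> * L) / (2 * \<gamma>) * (norm (u - v))\<^sup>2) \<le> DRE \<gamma> \<phi>1 \<phi>2 s"
proof -
  have "\<phi>1 v \<le> \<phi>1 u + inner (grad u) (v - u) + L / 2 * (norm (v - u))\<^sup>2"
    by (rule descent_lemma[OF GDERIV_grad lipschitz_grad])
  moreover have "(1 - \<gamma> * L) / (2 * \<gamma>) * (norm (u - v))\<^sup>2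
      = 1 / (2 * \<gamma>) * (norm (v - u))\<^sup>2 - L / 2 * (norm (v - u))\<^sup>2"
    using \<gamma>_pos by (simp add: norm_minus_commute field_simps)
  ultimately show ?thesis
    unfolding DRE_eq_fb_model[OF assms] fb_model_def by (cases "\<phi>2 v") auto
qed

text \<open>The model at \<open>w\<close> overestimates the cost at \<open>w\<close> by at most a multiple of the squared distance of \<open>w\<close>
  from \<open>u\<close>. With \<open>w\<close> a minimizer this makes the envelope grow at most quadratically around its minimum.\<close>

lemma DRE_upper_bound:
  assumes "(u, v) \<in> DRS \<gamma> \<phi>1 \<phi>2 s"
  shows "DRE \<gamma> \<phi>1 \<phi>2 s \<le> ereal (\<phi>1 w) + \<phi>2 w + ereal ((1 + \<gamma> * L) / (2 * \<gamma>) * (norm (u - w))\<^sup>2)"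
proof -
  have "- \<phi>1 w \<le> - \<phi>1 u + inner (- grad u) (w - u) + L / 2 * (norm (w - u))\<^sup>2"
  proof (rule descent_lemma)
    show "GDERIV (\<lambda>x. - \<phi>1 x) x :> - grad x" for x by (intro GDERIV_minus GDERIV_grad)
    show "L-lipschitz_on UNIV (\<lambda>x. - grad x)" using lipschitz_grad by simp
  qed
  moreover have "(1 + \<gamma> * L) / (2 * \<gamma>) * (norm (u - w))\<^sup>2
      = 1 / (2 * \<gamma>) * (norm (w - u))\<^sup>2 + L / 2 * (norm (w - u))\<^sup>2"
    using \<gamma>_pos by (simp add: norm_minus_commute field_simps)
  ultimately have "fb_model \<phi>2 u w \<le> ereal (\<phi>1 w) + \<phi>2 w + ereal ((1 + \<gamma> * L) / (2 * \<gamma>) * (norm (u - w))\<^sup>2)"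
    unfolding fb_model_def by (cases "\<phi>2 w") auto
  with DRS_minimizes_fb_model[OF assms, of w] show ?thesis
    unfolding DRE_eq_fb_model[OF assms] by (rule order_trans)
qed

text \<open>The only place where convexity of \<open>\<phi>1\<close> matters for the decrease of the envelope. The Bregman distance
  \<open>D\<close> compensates \<open>(norm Y)\<^sup>2\<close> through cocoercivity when \<open>\<phi>1\<close> is convex; otherwise \<open>D\<close> may be negative, but
  no less than \<open>- L / 2\<close> times the squared distance, and the smaller stepsize absorbs it.\<close>

lemma bregman_curvature_bound:
  fixes u u' :: 'a and relax :: real
  defines "Y \<equiv> \<gamma> *\<^sub>R grad u' - \<gamma> *\<^sub>R grad u"
    and "D \<equiv> \<phi>1 u - \<phi>1 u' - inner (grad u') (u - u')"
    and "m \<equiv> (if convex_on UNIV \<phi>1 then max (\<gamma> * L - relax / 2) 0 else 1)"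
  assumes relax: "0 < relax"
    and step: "convex_on UNIV \<phi>1 \<or> \<gamma> * (2 * L) \<le> 2 - relax"
  shows "(norm Y)\<^sup>2 - relax * \<gamma> * D \<le> \<gamma> * L * m * (norm (u - u'))\<^sup>2"
proof -
  define \<alpha> where "\<alpha> = \<gamma> * L"
  define \<Delta> where "\<Delta> = (norm (u - u'))\<^sup>2"
  have \<alpha>: "0 \<le> \<alpha>" using \<gamma>_pos L_nonneg by (simp add: \<alpha>_def)
  have "norm Y \<le> \<alpha> * norm (u - u')"
    using grad_displacement[of u' u] by (simp add: Y_def \<alpha>_def norm_minus_commute)
  then have Y: "(norm Y)\<^sup>2 \<le> \<alpha>\<^sup>2 * \<Delta>"
    unfolding \<Delta>_def by (metis norm_ge_zero power_mono power_mult_distrib)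
  show ?thesis
  proof (cases "convex_on UNIV \<phi>1")
    case True
    have "(norm Y)\<^sup>2 = \<gamma>\<^sup>2 * (norm (grad u - grad u'))\<^sup>2"
      by (simp add: Y_def power_mult_distrib norm_minus_commute flip: scaleR_diff_right)
    also have "\<dots> \<le> \<gamma>\<^sup>2 * (2 * L * D)"
      using convex_gradient_cocoercive[OF GDERIV_grad lipschitz_grad True, of u u']
      by (intro mult_left_mono) (simp_all add: D_def)
    finally have coco: "(norm Y)\<^sup>2 \<le> 2 * \<alpha> * (\<gamma> * D)"
      by (simp add: \<alpha>_def power2_eq_square algebra_simps)
    have D: "0 \<le> \<gamma> * D"
      using convex_above_tangent[OF GDERIV_grad True, of u' u] \<gamma>_pos by (simp add: D_def)
    show ?thesis
    proof (cases "\<alpha> \<le> relax / 2")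
      case True
      then have "2 * \<alpha> * (\<gamma> * D) \<le> relax * (\<gamma> * D)" using D by (intro mult_right_mono) auto
      with coco have "(norm Y)\<^sup>2 - relax * \<gamma> * D \<le> 0" by (simp add: mult.assoc)
      moreover have "m = 0" using True \<open>convex_on UNIV \<phi>1\<close> by (simp add: m_def \<alpha>_def)
      ultimately show ?thesis by simp
    next
      case False
      then have \<alpha>0: "0 < \<alpha>" and m: "m = \<alpha> - relax / 2"
        using relax \<open>convex_on UNIV \<phi>1\<close> by (auto simp: m_def \<alpha>_def)
      have "relax * ((norm Y)\<^sup>2) \<le> relax * (2 * \<alpha> * (\<gamma> * D))"
        using coco relax by (intro mult_left_mono) auto
      then have "2 * \<alpha> * ((norm Y)\<^sup>2 - relax * \<gamma> * D) \<le> 2 * \<alpha> * (norm Y)\<^sup>2 - relax * (norm Y)\<^sup>2"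
        by (simp add: algebra_simps)
      also have "\<dots> = (2 * \<alpha> - relax) * (norm Y)\<^sup>2" by (simp add: algebra_simps)
      also have "\<dots> \<le> (2 * \<alpha> - relax) * (\<alpha>\<^sup>2 * \<Delta>)" using Y False by (intro mult_left_mono) auto
      also have "\<dots> = 2 * \<alpha> * (\<alpha> * m * \<Delta>)" by (simp add: m power2_eq_square field_simps)
      finally have "(norm Y)\<^sup>2 - relax * \<gamma> * D \<le> \<alpha> * m * \<Delta>"
        using \<alpha>0 by (subst (asm) mult_le_cancel_left_pos) auto
      then show ?thesis by (simp only: \<alpha>_def \<Delta>_def)
    qed
  next
    case False
    have "\<phi>1 u' + inner (grad u') (u - u') \<le> \<phi>1 u + L / 2 * \<Delta>"
    proof -
      have "- \<phi>1 u \<le> - \<phi>1 u' + inner (- grad u') (u - u') + L / 2 * (norm (u - u'))\<^sup>2"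
        by (rule descent_lemma)
          (use lipschitz_grad in \<open>auto intro!: GDERIV_minus GDERIV_grad\<close>)
      then show ?thesis by (simp add: \<Delta>_def)
    qed
    then have "- D \<le> L / 2 * \<Delta>" by (simp add: D_def)
    then have "relax * \<gamma> * (- D) \<le> relax * \<gamma> * (L / 2 * \<Delta>)"
      using relax \<gamma>_pos by (intro mult_left_mono) auto
    with Y have "(norm Y)\<^sup>2 - relax * \<gamma> * D \<le> \<alpha>\<^sup>2 * \<Delta> + relax * \<alpha> / 2 * \<Delta>"
      by (simp add: \<alpha>_def algebra_simps)
    also have "\<dots> = \<alpha> * (\<alpha> + relax / 2) * \<Delta>" by (simp add: power2_eq_square algebra_simps)
    also have "\<dots> \<le> \<alpha> * 1 * \<Delta>"
      using \<alpha> step False by (intro mult_right_mono mult_left_mono) (auto simp: \<alpha>_def \<Delta>_def)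
    finally show ?thesis using False by (simp add: \<alpha>_def \<Delta>_def m_def)
  qed
qed

text \<open>The relaxed step \<open>s - relax *\<^sub>R r\<close> decreases the envelope. Both envelopes are compared through the model
  at the common point \<open>v\<close>: it is the minimizer for \<open>u\<close> and a competitor for \<open>u'\<close>. Since
  \<open>relax *\<^sub>R r = - (\<delta> + Y)\<close>, where \<open>\<delta>\<close> is the change of \<open>u\<close> and \<open>Y\<close> that of \<open>\<gamma> *\<^sub>R grad u\<close>, the difference of the
  two model values is a quadratic expression in \<open>\<delta>\<close> and \<open>Y\<close> plus a Bregman distance.\<close>

lemma nominal_step_decrease:
  assumes adm: "admissible_params \<phi>1 L \<gamma> relax c"
    and uv: "(u, v) \<in> DRS \<gamma> \<phi>1 \<phi>2 s"
    and uv': "(u', v') \<in> DRS \<gamma> \<phi>1 \<phi>2 (s - relax *\<^sub>R (u - v))"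
  shows "DRE \<gamma> \<phi>1 \<phi>2 (s - relax *\<^sub>R (u - v)) \<le> DRE \<gamma> \<phi>1 \<phi>2 s - ereal (c / \<gamma> * (norm (u - v))\<^sup>2)"
proof -
  define r where "r = u - v"
  define \<delta> where "\<delta> = u' - u"
  define Y where "Y = \<gamma> *\<^sub>R grad u' - \<gamma> *\<^sub>R grad u"
  define D where "D = \<phi>1 u - \<phi>1 u' - inner (grad u') (u - u')"
  define m where "m = (if convex_on UNIV \<phi>1 then max (\<gamma> * L - relax / 2) 0 else 1)"
  define K where "K = (2 - relax) / 2 - \<gamma> * L * m"
  define fb where "fb x = \<phi>1 x + inner (grad x) (v - x) + 1 / (2 * \<gamma>) * (norm (v - x))\<^sup>2" for x
  from adm have relax: "0 < relax" and c: "0 < c"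
    and cC: "c < relax / (1 + \<gamma> * L)\<^sup>2 * K"
    and step: "convex_on UNIV \<phi>1 \<or> \<gamma> * (2 * L) \<le> 2 - relax"
    by (auto simp: admissible_params_def C_const_def K_def m_def split: if_splits)
  have \<alpha>: "0 < 1 + \<gamma> * L" using \<gamma>_pos L_nonneg by (simp add: add_pos_nonneg)
  have "s - u = \<gamma> *\<^sub>R grad u" "s - relax *\<^sub>R r - u' = \<gamma> *\<^sub>R grad u'"
    using uv uv' by (auto simp: DRS_def r_def intro!: prox_stationary)
  then have rr: "relax *\<^sub>R r = - (\<delta> + Y)"
    by (simp add: \<delta>_def Y_def algebra_simps)
  have fb_diff: "\<gamma> * (fb u' - fb u) = - \<gamma> * D + inner (\<delta> - Y) r + (norm \<delta>)\<^sup>2 / 2"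
  proof -
    have vu: "v - u = - r" "v - u' = - r - \<delta>" "u - u' = - \<delta>"
      by (simp_all add: r_def \<delta>_def)
    show ?thesis
      unfolding fb_def D_def Y_def vu power2_norm_eq_inner
      using \<gamma>_pos by (simp add: inner_diff_left inner_diff_right inner_add_right
          inner_commute field_simps)
  qed
  have "relax * (\<gamma> * (fb u' - fb u))
      = - relax * \<gamma> * D + inner (\<delta> - Y) (relax *\<^sub>R r) + relax * (norm \<delta>)\<^sup>2 / 2"
    unfolding fb_diff by (simp add: algebra_simps)
  also have "inner (\<delta> - Y) (relax *\<^sub>R r) = (norm Y)\<^sup>2 - (norm \<delta>)\<^sup>2"
    unfolding rr power2_norm_eq_inner by (simp add: inner_commute algebra_simps)
  finally have "relax * (\<gamma> * (fb u' - fb u))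
      = ((norm Y)\<^sup>2 - relax * \<gamma> * D) - (1 - relax / 2) * (norm \<delta>)\<^sup>2"
    by (simp add: algebra_simps)
  also have "(norm Y)\<^sup>2 - relax * \<gamma> * D \<le> \<gamma> * L * m * (norm \<delta>)\<^sup>2"
    using bregman_curvature_bound[OF relax step, of u' u]
    by (simp add: Y_def D_def m_def \<delta>_def norm_minus_commute)
  finally have dec: "relax * (\<gamma> * (fb u' - fb u)) \<le> - (K * (norm \<delta>)\<^sup>2)"
    by (simp add: K_def algebra_simps diff_divide_distrib)
  have K: "0 < K"
  proof -
    have "0 < relax / (1 + \<gamma> * L)\<^sup>2 * K" using c cC by linarith
    then show ?thesis using relax \<alpha> by (simp add: zero_less_mult_iff zero_less_divide_iff)
  qed
  have "relax * norm r = norm (\<delta> + Y)"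
    using rr relax by (metis abs_of_pos norm_minus_cancel norm_scaleR)
  also have "\<dots> \<le> (1 + \<gamma> * L) * norm \<delta>"
    using norm_triangle_ineq[of \<delta> Y] grad_displacement[of u' u]
    by (simp add: Y_def \<delta>_def algebra_simps)
  finally have "(relax * norm r)\<^sup>2 \<le> ((1 + \<gamma> * L) * norm \<delta>)\<^sup>2"
    using relax by (intro power_mono) auto
  then have rd: "relax\<^sup>2 * (norm r)\<^sup>2 \<le> (1 + \<gamma> * L)\<^sup>2 * (norm \<delta>)\<^sup>2"
    by (simp add: power_mult_distrib)
  have "relax * (c * (norm r)\<^sup>2) \<le> relax * (relax / (1 + \<gamma> * L)\<^sup>2 * K * (norm r)\<^sup>2)"
    using cC relax by (intro mult_left_mono mult_right_mono) auto
  also have "\<dots> = K * (relax\<^sup>2 * (norm r)\<^sup>2 / (1 + \<gamma> * L)\<^sup>2)"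
    by (simp add: power2_eq_square)
  also have "\<dots> \<le> K * (norm \<delta>)\<^sup>2"
    using rd K \<alpha> by (intro mult_left_mono) (auto simp: divide_le_eq mult.commute)
  finally have "relax * (\<gamma> * (fb u' - fb u)) \<le> relax * (- (c * (norm r)\<^sup>2))"
    using dec by simp
  then have "\<gamma> * (fb u' - fb u) \<le> - (c * (norm r)\<^sup>2)"
    using relax by (simp only: mult_le_cancel_left_pos)
  then have mm: "fb u' \<le> fb u - c / \<gamma> * (norm r)\<^sup>2"
    using \<gamma>_pos by (simp add: field_simps)
  have "DRE \<gamma> \<phi>1 \<phi>2 (s - relax *\<^sub>R (u - v)) \<le> fb_model \<phi>2 u' v"
    using DRS_minimizes_fb_model[OF uv', of v] DRE_eq_fb_model[OF uv'] by simp
  also have "\<dots> = \<phi>2 v + ereal (fb u')" by (simp add: fb_model_def fb_def)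
  also have "\<dots> \<le> \<phi>2 v + ereal (fb u) - ereal (c / \<gamma> * (norm r)\<^sup>2)"
    using mm by (cases "\<phi>2 v") auto
  also have "\<phi>2 v + ereal (fb u) = DRE \<gamma> \<phi>1 \<phi>2 s"
    unfolding DRE_eq_fb_model[OF uv] by (simp add: fb_model_def fb_def)
  finally show ?thesis by (simp add: r_def)
qed

end

text \<open>This compares the decrease demanded by the linesearch with the margin \<open>(1 - \<alpha>) / 2\<close> that
  \<open>DRE_lower_bound\<close> leaves: a trial point with nearly minimal envelope value meets the demand. With
  \<open>x = relax / 2\<close> the claim is a quadratic inequality in \<open>x\<close>. For nonconvex \<open>f\<close> the quadratic peaks at
  \<open>x = (1 - \<alpha>) / 2\<close>. For convex \<open>f\<close> it is bounded by its peak at \<open>x = (1 + \<alpha>) / 2\<close> when \<open>x \<le> \<alpha>\<close>; when \<open>\<alpha> \<le> x\<close>,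
  it is largest at \<open>1 / 2\<close> or at the end point \<open>\<alpha>\<close>, whichever is larger.\<close>

lemma C_const_le_half:
  assumes \<alpha>: "0 \<le> \<alpha>" "\<alpha> < 1" and relax: "0 < relax"
  shows "C_const f \<alpha> relax \<le> (1 - \<alpha>) / 2"
proof -
  define x where "x = relax / 2"
  have x: "0 < x" using relax by (simp add: x_def)
  have bound: "2 * x * (1 - x - \<alpha> * m) \<le> (1 - \<alpha>) / 2 * (1 + \<alpha>)\<^sup>2"
    if m: "m = (if convex_on UNIV f then max (\<alpha> - x) 0 else 1)" for m
  proof -
    \<comment> \<open>The last two cases split at \<open>\<alpha> = 1 / 2\<close>, where \<open>\<alpha>\<close> passes the maximizer of \<open>x * (1 - x)\<close>.\<close>
    consider "m = 1" | "m = \<alpha> - x" "x \<le> \<alpha>" | "m = 0" "\<alpha> \<le> x" "\<alpha> \<le> 1/2" | "m = 0" "\<alpha> \<le> x" "1/2 \<le> \<alpha>"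
      using m by (fastforce split: if_splits simp: max_def)
    then show ?thesis
    proof cases
      case 1
      have "0 \<le> (2 * x - (1 - \<alpha>))\<^sup>2" by simp
      then have "2 * x * (1 - x - \<alpha>) \<le> (1 - \<alpha>) / 2 * (1 - \<alpha>)"
        by (simp add: power2_eq_square field_simps)
      also have "\<dots> \<le> (1 - \<alpha>) / 2 * (1 + \<alpha>)\<^sup>2"
        using \<alpha> by (intro mult_left_mono) (auto simp: power2_eq_square field_simps)
      finally show ?thesis using 1 by simp
    next
      case 2
      have "0 \<le> (2 * x - (1 + \<alpha>))\<^sup>2" by simp
      then have "4 * (x * (1 + \<alpha> - x)) \<le> (1 + \<alpha>)\<^sup>2" by (simp add: power2_eq_square field_simps)
      then have "(1 - \<alpha>) / 2 * (4 * (x * (1 + \<alpha> - x))) \<le> (1 - \<alpha>) / 2 * (1 + \<alpha>)\<^sup>2"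
        using \<alpha> by (intro mult_left_mono) auto
      moreover have "2 * x * (1 - x - \<alpha> * m) = (1 - \<alpha>) / 2 * (4 * (x * (1 + \<alpha> - x)))"
        unfolding \<open>m = \<alpha> - x\<close> by (simp add: field_simps)
      ultimately show ?thesis by (simp only:)
    next
      case 3
      have "0 \<le> (2 * x - 1)\<^sup>2" by simp
      then have "2 * x * (1 - x) \<le> 1 / 2" by (simp add: power2_eq_square field_simps)
      also have "\<dots> \<le> (1 - \<alpha>) / 2 * (1 + \<alpha>)\<^sup>2"
      proof -
        have "0 \<le> \<alpha> * (1 - \<alpha> - \<alpha> * \<alpha>)"
          using \<alpha> 3 mult_mono[of \<alpha> "1/2" \<alpha> "1/2"] by (intro mult_nonneg_nonneg) auto
        then show ?thesis by (simp add: power2_eq_square field_simps)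
      qed
      finally show ?thesis using 3 by simp
    next
      case 4
      have "0 \<le> (x - \<alpha>) * (x + \<alpha> - 1)" using 4 by (intro mult_nonneg_nonneg) auto
      then have "2 * x * (1 - x) \<le> (1 - \<alpha>) / 2 * (4 * \<alpha>)" by (simp add: field_simps)
      also have "\<dots> \<le> (1 - \<alpha>) / 2 * (1 + \<alpha>)\<^sup>2"
      proof (intro mult_left_mono)
        have "0 \<le> (1 - \<alpha>)\<^sup>2" by simp
        then show "4 * \<alpha> \<le> (1 + \<alpha>)\<^sup>2" by (simp add: power2_eq_square field_simps)
      qed (use \<alpha> in simp)
      finally show ?thesis using 4 by simp
    qed
  qed
  have "C_const f \<alpha> relax
      = 2 * x * (1 - x - \<alpha> * (if convex_on UNIV f then max (\<alpha> - x) 0 else 1)) / (1 + \<alpha>)\<^sup>2"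
    by (simp add: C_const_def Let_def x_def diff_divide_distrib)
  also have "\<dots> \<le> (1 - \<alpha>) / 2"
    using bound[OF refl] \<alpha> by (simp add: divide_le_eq)
  finally show ?thesis .
qed

section \<open>The modified Broyden update\<close>

lemma outer_product_mult_vector: "outer_product a b *v x = inner b x *\<^sub>R a"
  by (simp add: vec_eq_iff outer_product_def matrix_vector_mult_def inner_vec_def
      sum_distrib_right sum_distrib_left algebra_simps)

text \<open>The inner product on the matrix type is the Frobenius one, and \<open>norm\<close> is the Frobenius norm.\<close>

lemma inner_outer_product: "inner A (outer_product a b) = inner a (A *v b)"
  for A :: "real^'m^'n"
  by (simp add: inner_vec_def outer_product_def matrix_vector_mult_def sum_distrib_left algebra_simps)

lemma norm_outer_product: "norm (outer_product a b) = norm a * norm b"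
proof -
  have "(norm (outer_product a b))\<^sup>2 = (norm a * norm b)\<^sup>2"
    unfolding power2_norm_eq_inner inner_outer_product outer_product_mult_vector
    by (simp add: dot_square_norm power_mult_distrib)
  then show ?thesis by (simp add: power2_eq_iff_nonneg)
qed

text \<open>The Frobenius norm dominates the operator norm: test \<open>A\<close> against the rank-one matrix built from
  \<open>A *v x\<close> and \<open>x\<close>, and use the Cauchy--Schwarz inequality for matrices.\<close>

lemma norm_matrix_vector_mult_le: "norm (A *v x) \<le> norm A * norm x"
  for A :: "real^'m^'n"
proof -
  have "norm (A *v x) * norm (A *v x) = inner A (outer_product (A *v x) x)"
    by (simp add: inner_outer_product dot_square_norm power2_eq_square)
  also have "\<dots> \<le> norm A * (norm (A *v x) * norm x)"
    by (metis norm_cauchy_schwarz norm_outer_product)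
  finally have "norm (A *v x) * norm (A *v x) \<le> norm (A *v x) * (norm A * norm x)"
    by (simp add: ac_simps)
  then show ?thesis
    by (cases "norm (A *v x) = 0") auto
qed

text \<open>The safeguard keeps the damping factor near \<open>1\<close> and the denominator of the update away from \<open>0\<close>.\<close>

lemma broyden_theta_bounds:
  assumes "0 < \<theta>_bar" "\<theta>_bar < 1"
  shows "\<bar>1 - broyden_theta \<theta>_bar \<delta>\<bar> \<le> \<theta>_bar"
    and "1 / broyden_theta \<theta>_bar \<delta> - 1 + \<delta> \<noteq> 0"
    and "broyden_theta \<theta>_bar \<delta> > 0"
proof -
  have "\<delta> * \<theta>_bar \<le> \<delta>" if "0 \<le> \<delta>" using that assms by (simp add: mult_left_le)
  moreover have "\<delta> * \<theta>_bar \<le> 0" if "\<delta> < 0" using that assms by (simp add: mult_nonpos_nonneg)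
  ultimately show "\<bar>1 - broyden_theta \<theta>_bar \<delta>\<bar> \<le> \<theta>_bar"
    using assms by (auto simp: broyden_theta_def field_simps abs_le_iff)
qed (use assms in \<open>auto simp: broyden_theta_def field_simps\<close>)

text \<open>The Sherman--Morrison formula: the update of \<open>H\<close> is the inverse of a damped Broyden rank-one correction
  of \<open>B\<close>, the inverse of \<open>H\<close>.\<close>

lemma broyden_update_inverse:
  fixes B H :: "real^'n^'n"
  assumes HB: "H ** B = mat 1" and p: "p \<noteq> 0" and \<theta>_bar: "0 < \<theta>_bar" "\<theta>_bar < 1"
  obtains \<theta> where "\<bar>1 - \<theta>\<bar> \<le> \<theta>_bar"
    and "broyden_update \<theta>_bar H p q ** (B + outer_product ((\<theta> / (norm p)\<^sup>2) *\<^sub>R (q - B *v p)) p) = mat 1"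
proof
  define \<delta> where "\<delta> = inner (H *v q) p / (norm p)\<^sup>2"
  define \<theta> where "\<theta> = broyden_theta \<theta>_bar \<delta>"
  define D where "D = inner p ((1 / \<theta> - 1) *\<^sub>R p + H *v q)"
  show "\<bar>1 - \<theta>\<bar> \<le> \<theta>_bar" unfolding \<theta>_def by (rule broyden_theta_bounds[OF \<theta>_bar])
  have np: "(norm p)\<^sup>2 \<noteq> 0" using p by simp
  have Hq: "inner p (H *v q) = \<delta> * (norm p)\<^sup>2"
    using np by (simp add: \<delta>_def inner_commute)
  have D: "D = (norm p)\<^sup>2 * (1 / \<theta> - 1 + \<delta>)"
    by (simp add: D_def inner_add_right Hq power2_norm_eq_inner algebra_simps)
  have nz: "1 / \<theta> - 1 + \<delta> \<noteq> 0" and \<theta>: "\<theta> > 0"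
    unfolding \<theta>_def by (rule broyden_theta_bounds[OF \<theta>_bar])+
  have coeff: "\<theta> / (norm p)\<^sup>2 * (1 + (1 / D) * ((1 - \<delta>) * (norm p)\<^sup>2)) = 1 / D"
    unfolding D using \<theta> np nz by (simp add: divide_simps) (simp add: algebra_simps)
  have BH: "B ** H = mat 1" using HB matrix_left_right_inverse by blast
  have BHv: "B *v (H *v x) = x" for x by (simp add: matrix_vector_mul_assoc BH)
  let ?H' = "broyden_update \<theta>_bar H p q"
  let ?B' = "B + outer_product ((\<theta> / (norm p)\<^sup>2) *\<^sub>R (q - B *v p)) p"
  have "?B' ** ?H' = mat 1"
  proof (rule matrix_eq[THEN iffD2], rule allI)
    fix x
    define z where "z = H *v x"
    have H': "?H' *v x = z + ((1 / D) * inner p z) *\<^sub>R (p - H *v q)"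
      by (simp add: broyden_update_def Let_def z_def D_def \<theta>_def \<delta>_def matrix_vector_mult_add_rdistrib
          scaleR_matrix_vector_assoc[symmetric] outer_product_mult_vector dot_lmul_matrix)
    have B': "?B' *v w = B *v w + (inner p w * (\<theta> / (norm p)\<^sup>2)) *\<^sub>R (q - B *v p)" for w
      by (simp add: matrix_vector_mult_add_rdistrib outer_product_mult_vector)
    have "B *v (?H' *v x) = x + ((1 / D) * inner p z) *\<^sub>R (B *v p - q)"
      unfolding H' by (simp add: matrix_vector_right_distrib matrix_vector_mult_scaleR
          matrix_vector_mult_diff_distrib BHv z_def)
    then have "?B' *v (?H' *v x) = x + ((1 / D) * inner p z) *\<^sub>R (B *v p - q)
        + (inner p (?H' *v x) * (\<theta> / (norm p)\<^sup>2)) *\<^sub>R (q - B *v p)"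
      by (simp only: B')
    also have "\<dots> = x + (inner p (?H' *v x) * (\<theta> / (norm p)\<^sup>2) - (1 / D) * inner p z) *\<^sub>R (q - B *v p)"
      by (simp add: algebra_simps)
    also have "inner p (?H' *v x) = inner p z * (1 + (1 / D) * ((1 - \<delta>) * (norm p)\<^sup>2))"
      by (simp add: H' inner_add_right inner_diff_right Hq power2_norm_eq_inner algebra_simps)
    also have "\<dots> * (\<theta> / (norm p)\<^sup>2)
        = (\<theta> / (norm p)\<^sup>2 * (1 + (1 / D) * ((1 - \<delta>) * (norm p)\<^sup>2))) * inner p z"
      by (simp add: ac_simps)
    also have "\<dots> - (1 / D) * inner p z = 0" by (simp only: coeff)
    finally show "(?B' ** ?H') *v x = mat 1 *v x" by (simp add: matrix_vector_mul_assoc)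
  qed
  then show "?H' ** ?B' = mat 1" using matrix_left_right_inverse by blast
qed


text \<open>For \<open>\<theta> = 1\<close> the correction replaces the action of \<open>E\<close> along \<open>p\<close> by \<open>y\<close> and keeps the orthogonal
  complement of \<open>p\<close> fixed. With damping, the new action along \<open>p\<close> is the combination
  \<open>(1 - \<theta>) *\<^sub>R E p + \<theta> *\<^sub>R y\<close>, whose first coefficient has modulus at most \<open>\<theta>_bar < 1\<close>. So a fixed fraction of the
  squared error along \<open>p\<close> is removed from the squared Frobenius norm, and \<open>y\<close> contributes only to second
  order; this is why square summability suffices below.\<close>

lemma rank_one_correction_error:
  fixes E :: "real^'n^'n"
  assumes p: "p \<noteq> 0" and \<theta>: "\<bar>1 - \<theta>\<bar> \<le> \<theta>_bar" and \<theta>_bar: "0 < \<theta>_bar" "\<theta>_bar < 1"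
  shows "(norm (E + outer_product ((\<theta> / (norm p)\<^sup>2) *\<^sub>R (y - E *v p)) p))\<^sup>2
    \<le> (norm E)\<^sup>2 - (1 - \<theta>_bar) * (norm (E *v p) / norm p)\<^sup>2
       + 4 / (1 - \<theta>_bar) * (norm y / norm p)\<^sup>2"
proof -
  define n where "n = norm p"
  have n: "n > 0" using p by (simp add: n_def)
  define e where "e = E *v p"
  let ?O = "outer_product ((\<theta> / n\<^sup>2) *\<^sub>R (y - e)) p"
  have O: "(norm ?O)\<^sup>2 = (\<theta> / n\<^sup>2)\<^sup>2 * (norm (y - e))\<^sup>2 * n\<^sup>2"
    unfolding power2_norm_eq_inner[of ?O] inner_outer_product outer_product_mult_vector
    by (simp add: dot_square_norm n_def power2_eq_square)
  have "(norm (E + ?O))\<^sup>2 = (norm E)\<^sup>2 + 2 * inner E ?O + (norm ?O)\<^sup>2"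
    by (simp add: power2_norm_eq_inner inner_add_left inner_add_right inner_commute)
  also have "\<dots> = (norm E)\<^sup>2 + (2 * \<theta> * inner e (y - e) + \<theta>\<^sup>2 * (norm (y - e))\<^sup>2) / n\<^sup>2"
    unfolding O inner_outer_product using n
    by (simp add: e_def[symmetric] inner_commute inner_diff_right field_simps power2_eq_square)
  also have "2 * \<theta> * inner e (y - e) + \<theta>\<^sup>2 * (norm (y - e))\<^sup>2 = (norm ((1 - \<theta>) *\<^sub>R e + \<theta> *\<^sub>R y))\<^sup>2 - (norm e)\<^sup>2"
  proof -
    have "(1 - \<theta>) *\<^sub>R e + \<theta> *\<^sub>R y = e + \<theta> *\<^sub>R (y - e)" by (simp add: algebra_simps)
    then show ?thesis
      unfolding power2_norm_eq_inner
      by (simp add: inner_add_left inner_add_right inner_commute power2_eq_square)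
  qed
  also have "(norm ((1 - \<theta>) *\<^sub>R e + \<theta> *\<^sub>R y))\<^sup>2 \<le> \<theta>_bar * (norm e)\<^sup>2 + 4 / (1 - \<theta>_bar) * (norm y)\<^sup>2"
  proof -
    have "norm ((1 - \<theta>) *\<^sub>R e + \<theta> *\<^sub>R y) \<le> \<bar>1 - \<theta>\<bar> * norm e + \<bar>\<theta>\<bar> * norm y"
      by (metis norm_scaleR norm_triangle_ineq)
    also have "\<dots> \<le> \<theta>_bar * norm e + 2 * norm y"
      using \<theta> \<theta>_bar by (intro add_mono mult_right_mono) auto
    finally have "(norm ((1 - \<theta>) *\<^sub>R e + \<theta> *\<^sub>R y))\<^sup>2 \<le> (\<theta>_bar * norm e + 2 * norm y)\<^sup>2"
      by (intro power_mono) auto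
    also have "\<dots> \<le> \<theta>_bar * (norm e)\<^sup>2 + 4 / (1 - \<theta>_bar) * (norm y)\<^sup>2"
    proof -
      \<comment> \<open>Convexity of the square, with \<open>2 * norm y\<close> written as \<open>1 - \<theta>_bar\<close> times its quotient.\<close>
      have "(\<theta>_bar *\<^sub>R norm e + (1 - \<theta>_bar) *\<^sub>R (2 * norm y / (1 - \<theta>_bar)))\<^sup>2
          \<le> \<theta>_bar * (norm e)\<^sup>2 + (1 - \<theta>_bar) * (2 * norm y / (1 - \<theta>_bar))\<^sup>2"
        using convex_onD[OF convex_power2, of "1 - \<theta>_bar" "norm e" "2 * norm y / (1 - \<theta>_bar)"] \<theta>_bar
        by simp
      also have "(1 - \<theta>_bar) * (2 * norm y / (1 - \<theta>_bar))\<^sup>2 = 4 / (1 - \<theta>_bar) * (norm y)\<^sup>2"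
      proof -
        have "w * (2 * norm y / w)\<^sup>2 = 4 / w * (norm y)\<^sup>2" if "0 < w" for w
          using that by (simp add: power2_eq_square field_simps)
        then show ?thesis using \<theta>_bar by simp
      qed
      finally show ?thesis using \<theta>_bar by simp
    qed
    finally show ?thesis .
  qed
  finally have "(norm (E + ?O))\<^sup>2
      \<le> (norm E)\<^sup>2 + (\<theta>_bar * (norm e)\<^sup>2 + 4 / (1 - \<theta>_bar) * (norm y)\<^sup>2 - (norm e)\<^sup>2) / n\<^sup>2"
    using n by (simp add: divide_right_mono)
  also have "\<dots> = (norm E)\<^sup>2 - (1 - \<theta>_bar) * (norm e / n)\<^sup>2 + 4 / (1 - \<theta>_bar) * (norm y / n)\<^sup>2"
    using n \<theta>_bar by (simp add: power_divide field_simps)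
  finally show ?thesis by (simp add: e_def n_def)
qed

lemma summable_if_telescoping:
  fixes a x b :: "nat \<Rightarrow> real"
  assumes "\<And>k. a (Suc k) \<le> a k - x k + b k" and "\<And>k. l \<le> a k" and "\<And>k. 0 \<le> x k"
    and "summable b" and "\<And>k. 0 \<le> b k"
  shows "summable x"
proof (rule summableI_nonneg_bounded)
  fix n
  have "(\<Sum>k<n. x k) \<le> a 0 - a n + (\<Sum>k<n. b k)"
  proof (induction n)
    case (Suc n)
    then show ?case using assms(1)[of n] by simp
  qed simp
  also have "(\<Sum>k<n. b k) \<le> suminf b" using assms by (intro sum_le_suminf) auto
  finally show "(\<Sum>k<n. x k) \<le> a 0 - l + suminf b" using assms(2)[of n] by linarith
qed (use assms in auto)

lemma modified_broyden_invertible: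
  assumes mb: "modified_broyden \<theta>_bar H0 H r r0 d" and H0: "invertible H0"
    and \<theta>_bar: "0 < \<theta>_bar" "\<theta>_bar < 1" and r: "\<And>k. r k \<noteq> 0"
  shows "invertible (H k) \<and> d k \<noteq> 0"
proof -
  have d: "d k \<noteq> 0" if "invertible (H k)" for k
  proof
    assume "d k = 0"
    then have "H k *v r k = 0" using mb by (simp add: modified_broyden_def)
    with that r[of k] show False using matrix_left_invertible_ker invertible_def by blast
  qed
  have "invertible (H k)"
  proof (induction k)
    case 0
    then show ?case using mb H0 by (simp add: modified_broyden_def)
  next
    case (Suc k)
    obtain B where "H k ** B = mat 1" using Suc invertible_def by blast
    from broyden_update_inverse[OF this d[OF Suc] \<theta>_bar]
    have "\<exists>B'. broyden_update \<theta>_bar (H k) (d k) (r0 k - r k) ** B' = mat 1" by metis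
    then show ?case
      using mb matrix_left_right_inverse unfolding modified_broyden_def invertible_def by metis
  qed
  with d show ?thesis by blast
qed

text \<open>Apply the error estimate to \<open>E k = B k - J\<close>, where \<open>B k\<close> is the inverse of \<open>H k\<close>. Along the direction
  \<open>d k\<close> this error is \<open>- (r k + J *v d k)\<close> because \<open>B k *v d k = - r k\<close>. The squared norms of \<open>E k\<close> telescope, and the
  relative errors along the directions are square summable.\<close>

proposition modified_broyden_dennis_more:
  fixes H :: "nat \<Rightarrow> real^'n^'n"
  assumes mb: "modified_broyden \<theta>_bar H0 H r r0 d" and H0: "invertible H0"
    and \<theta>_bar: "0 < \<theta>_bar" "\<theta>_bar < 1" and r: "\<And>k. r k \<noteq> 0"
    and summ: "summable (\<lambda>k. (norm (r0 k - r k - J *v d k) / norm (d k))\<^sup>2)"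
  shows "(\<lambda>k. norm (r k + J *v d k) / norm (d k)) \<longlonglongrightarrow> 0"
proof -
  note inv = modified_broyden_invertible[OF mb H0 \<theta>_bar r]
  have "\<forall>k. \<exists>B. H k ** B = mat 1" using inv by (simp add: invertible_right_inverse)
  then obtain B where HB: "\<And>k. H k ** B k = mat 1" using choice[of "\<lambda>k B. H k ** B = mat 1"] by auto
  then have BH: "B k ** H k = mat 1" for k using matrix_left_right_inverse by blast
  have B_unique: "B k = X" if "H k ** X = mat 1" for X k
  proof -
    have "B k ** (H k ** X) = X" by (simp add: matrix_mul_assoc BH)
    then show ?thesis by (simp add: that)
  qed
  define E where "E k = B k - J" for k
  have Ed: "E k *v d k = - (r k + J *v d k)" for k
  proof -
    have "B k *v (H k *v r k) = r k" by (simp add: matrix_vector_mul_assoc BH)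
    moreover have "d k = - (H k *v r k)" using mb by (simp add: modified_broyden_def)
    moreover have "B k *v (- (H k *v r k)) = - (B k *v (H k *v r k))"
      by (simp add: linear_neg[OF matrix_vector_mul_linear])
    ultimately have "B k *v d k = - r k" by metis
    then show ?thesis by (simp add: E_def matrix_vector_mult_diff_rdistrib)
  qed
  have step: "(norm (E (Suc k)))\<^sup>2 \<le> (norm (E k))\<^sup>2
      - (1 - \<theta>_bar) * (norm (r k + J *v d k) / norm (d k))\<^sup>2
      + 4 / (1 - \<theta>_bar) * (norm (r0 k - r k - J *v d k) / norm (d k))\<^sup>2" for k
  proof -
    obtain \<theta> where \<theta>: "\<bar>1 - \<theta>\<bar> \<le> \<theta>_bar"
      and "broyden_update \<theta>_bar (H k) (d k) (r0 k - r k) ** (B k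
        + outer_product ((\<theta> / (norm (d k))\<^sup>2) *\<^sub>R (r0 k - r k - B k *v d k)) (d k)) = mat 1"
      using inv[of k] by (auto elim: broyden_update_inverse[OF HB _ \<theta>_bar, of "d k" k "r0 k - r k"])
    then have "B (Suc k) = B k
        + outer_product ((\<theta> / (norm (d k))\<^sup>2) *\<^sub>R (r0 k - r k - B k *v d k)) (d k)"
      using mb by (intro B_unique) (simp add: modified_broyden_def)
    then have "E (Suc k) = E k
        + outer_product ((\<theta> / (norm (d k))\<^sup>2) *\<^sub>R (r0 k - r k - J *v d k - E k *v d k)) (d k)"
    proof -
      have "r0 k - r k - J *v d k - E k *v d k = r0 k - r k - B k *v d k"
        by (simp add: E_def matrix_vector_mult_diff_rdistrib)
      then show ?thesis
        by (simp only:) (simp add: E_def \<open>B (Suc k) = _\<close>)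
    qed
    moreover have "norm (E k *v d k) = norm (r k + J *v d k)"
      unfolding Ed by (rule norm_minus_cancel)
    ultimately show ?thesis
      using rank_one_correction_error[OF conjunct2[OF inv[of k]] \<theta> \<theta>_bar, of "E k" "r0 k - r k - J *v d k"]
      by (simp only:)
  qed
  have "summable (\<lambda>k. (1 - \<theta>_bar) * (norm (r k + J *v d k) / norm (d k))\<^sup>2)"
  proof (rule summable_if_telescoping)
    show "summable (\<lambda>k. 4 / (1 - \<theta>_bar) * (norm (r0 k - r k - J *v d k) / norm (d k))\<^sup>2)"
      by (rule summable_mult[OF summ])
    show "0 \<le> (norm (E k))\<^sup>2" for k by simp
  qed (use \<theta>_bar step in auto)
  then have "summable (\<lambda>k. (norm (r k + J *v d k) / norm (d k))\<^sup>2)"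
    using \<theta>_bar by (simp add: summable_cmult_iff)
  from summable_LIMSEQ_zero[OF this] show ?thesis by simp
qed

section \<open>Maps with Lipschitz-continuous directional derivatives\<close>

text \<open>A mean value inequality for one-sided derivatives. Relax the bound \<open>M\<close> slightly and
  let \<open>c\<close> be the infimum of the points where the relaxed bound fails. By continuity it still holds at \<open>c\<close>, and the
  right derivative at \<open>c\<close> extends it beyond \<open>c\<close>, a contradiction.\<close>

lemma right_derivative_increment_bound:
  fixes h :: "real \<Rightarrow> 'b::real_normed_vector"
  assumes ab: "a \<le> b" and cont: "continuous_on {a..b} h"
    and deriv: "\<And>t. a \<le> t \<Longrightarrow> t < b \<Longrightarrow> ((\<lambda>e. (h (t + e) - h t) /\<^sub>R e) \<longlongrightarrow> h' t) (at_right 0)"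
    and bound: "\<And>t. a \<le> t \<Longrightarrow> t < b \<Longrightarrow> norm (h' t) \<le> M"
  shows "norm (h b - h a) \<le> M * (b - a)"
proof (rule field_le_epsilon)
  fix \<epsilon> :: real assume \<epsilon>: "0 < \<epsilon>"
  define \<eta> where "\<eta> = \<epsilon> / (b - a + 1)"
  have \<eta>: "0 < \<eta>" using \<epsilon> ab by (simp add: \<eta>_def)
  define T where "T = {t \<in> {a..b}. norm (h t - h a) > (M + \<eta>) * (t - a)}"
  have "T = {}"
  proof (rule ccontr)
    assume "T \<noteq> {}"
    have bdd: "bdd_below T" by (rule bdd_belowI[of _ a]) (auto simp: T_def)
    define c where "c = Inf T"
    have cab: "a \<le> c" "c \<le> b"
      using \<open>T \<noteq> {}\<close> bdd cInf_lower[OF _ bdd] unfolding c_def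
      by (auto intro!: cInf_greatest simp: T_def intro: order_trans)
    have below: "norm (h t - h a) \<le> (M + \<eta>) * (t - a)" if "a \<le> t" "t < c" for t
      using cInf_lower[OF _ bdd, of t] that cab by (force simp: T_def c_def)
    have c: "norm (h c - h a) \<le> (M + \<eta>) * (c - a)"
    proof (cases "a = c")
      case False
      then have ac: "a < c" using cab by simp
      have lim: "(h \<longlongrightarrow> h c) (at_left c)"
      proof -
        have "(h \<longlongrightarrow> h c) (at c within {a..b})"
          using cont cab by (simp add: continuous_on_def)
        then have "(h \<longlongrightarrow> h c) (at c within {a..c})"
          by (rule tendsto_within_subset) (use cab in auto)
        then show ?thesis using ac by (simp add: at_within_Icc_at_left)
      qed
      show ?thesis
      proof (rule tendsto_le[where F = "at_left c"])
        show "((\<lambda>t. norm (h t - h a)) \<longlongrightarrow> norm (h c - h a)) (at_left c)"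
          by (intro tendsto_intros lim)
        show "((\<lambda>t. (M + \<eta>) * (t - a)) \<longlongrightarrow> (M + \<eta>) * (c - a)) (at_left c)"
          by (intro tendsto_intros)
        show "\<forall>\<^sub>F t in at_left c. norm (h t - h a) \<le> (M + \<eta>) * (t - a)"
          using eventually_at_left_real[OF ac] by eventually_elim (auto intro: below)
      qed simp
    qed simp
    then have "c \<notin> T" by (simp add: T_def)
    have cb: "c < b"
    proof (rule ccontr)
      assume "\<not> c < b"
      then have "T \<subseteq> {c}"
        using cab cInf_lower[OF _ bdd] by (force simp: c_def T_def)
      with \<open>c \<notin> T\<close> \<open>T \<noteq> {}\<close> show False by auto
    qed
    have "((\<lambda>e. norm ((h (c + e) - h c) /\<^sub>R e)) \<longlongrightarrow> norm (h' c)) (at_right 0)"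
      by (intro tendsto_norm deriv cab cb)
    moreover have "norm (h' c) < M + \<eta>" using bound[OF cab(1) cb] \<eta> by simp
    ultimately have "\<forall>\<^sub>F e in at_right 0. norm ((h (c + e) - h c) /\<^sub>R e) < M + \<eta>"
      by (rule order_tendstoD)
    then obtain \<rho> where \<rho>: "0 < \<rho>"
      and quot: "\<And>e. 0 < e \<Longrightarrow> e < \<rho> \<Longrightarrow> norm ((h (c + e) - h c) /\<^sub>R e) < M + \<eta>"
      unfolding eventually_at_right_field by auto
    have "c + \<rho> \<le> t" if "t \<in> T" for t
    proof (rule ccontr)
      assume "\<not> c + \<rho> \<le> t"
      moreover have "c \<le> t" using that bdd by (simp add: c_def cInf_lower)
      ultimately have e: "0 < t - c" "t - c < \<rho>"
        using that \<open>c \<notin> T\<close> by (auto simp: le_less)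
      have "norm (h t - h c) \<le> (M + \<eta>) * (t - c)"
      proof -
        have "norm (h t - h c) / (t - c) < M + \<eta>"
          using quot[OF e] e unfolding norm_scaleR by (simp add: divide_inverse mult.commute)
        then show ?thesis using e by (simp add: divide_less_eq)
      qed
      then have "norm (h t - h a) \<le> (M + \<eta>) * (t - a)"
        using norm_triangle_ineq[of "h t - h c" "h c - h a"] c by (simp add: algebra_simps)
      with that show False by (simp add: T_def)
    qed
    then have "c + \<rho> \<le> c" unfolding c_def using \<open>T \<noteq> {}\<close> by (intro cInf_greatest) auto
    with \<rho> show False by simp
  qed
  then have "norm (h b - h a) \<le> (M + \<eta>) * (b - a)" using ab by (auto simp: T_def not_less)
  also have "\<dots> \<le> M * (b - a) + \<epsilon>"
  proof -
    have "\<eta> * (b - a) \<le> \<eta> * (b - a + 1)" using \<eta> by (intro mult_left_mono) auto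
    also have "\<dots> = \<epsilon>" using ab by (simp add: \<eta>_def)
    finally show ?thesis by (simp add: algebra_simps)
  qed
  finally show "norm (h b - h a) \<le> M * (b - a) + \<epsilon>" .
qed

lemma has_derivative_imp_right_directional:
  assumes "(f has_derivative f') (at x)"
  shows "((\<lambda>t. (f (x + t *\<^sub>R w) - f x) /\<^sub>R t) \<longlongrightarrow> f' w) (at_right (0::real))"
proof -
  have "((\<lambda>t. f (x + t *\<^sub>R w)) has_derivative (\<lambda>t. f' (t *\<^sub>R w))) (at 0)"
    by (rule has_derivative_compose[where f = "\<lambda>t. x + t *\<^sub>R w" and g = f])
      (use assms in \<open>auto intro!: derivative_eq_intros\<close>)
  moreover have "f' (t *\<^sub>R w) = t *\<^sub>R f' w" for t
    using assms by (simp add: has_derivative_bounded_linear bounded_linear.linear linear_scale)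
  ultimately have "((\<lambda>t. f (x + t *\<^sub>R w)) has_derivative (\<lambda>t. t *\<^sub>R f' w)) (at_right 0)"
    by (simp add: has_derivative_at_withinI)
  then have "((\<lambda>t. (f (x + t *\<^sub>R w) - (f x + t *\<^sub>R f' w)) /\<^sub>R norm t) \<longlongrightarrow> 0) (at_right 0)"
    by (simp add: has_derivative_within divide_inverse)
  moreover have "\<forall>\<^sub>F t in at_right (0::real). (f (x + t *\<^sub>R w) - (f x + t *\<^sub>R f' w)) /\<^sub>R norm t
      = (f (x + t *\<^sub>R w) - f x) /\<^sub>R t - f' w"
    using eventually_at_right_less[of "0::real"] by eventually_elim (simp add: algebra_simps)
  ultimately have "((\<lambda>t. (f (x + t *\<^sub>R w) - f x) /\<^sub>R t - f' w) \<longlongrightarrow> 0) (at_right 0)"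
    by (rule Lim_transform_eventually)
  then show ?thesis by (rule LIM_zero_cancel)
qed

text \<open>Directional derivatives that are Lipschitz at \<open>x0\<close> give the second-order estimate known for
  maps with Lipschitz Jacobian, also off the base point. On a segment, subtract the linear map \<open>f'\<close>: the right
  derivative that remains is \<open>DF (x + t *\<^sub>R w) w - DF x0 w\<close>, since \<open>DF x0\<close> coincides with \<open>f'\<close>.\<close>

lemma strict_differentiability_estimate:
  fixes F :: "'a::real_normed_vector \<Rightarrow> 'b::real_normed_vector set"
  assumes sd: "lipschitz_semidifferentiable_at F x0"
    and der: "((the_elem \<circ> F) has_derivative f') (at x0)"
  obtains \<rho> K where "0 < \<rho>" "0 < K"
    and "\<And>x. x \<in> ball x0 \<rho> \<Longrightarrow> is_singleton (F x)"
    and "\<And>x w. x \<in> ball x0 \<rho> \<Longrightarrow> x + w \<in> ball x0 \<rho> \<Longrightarrow>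
      norm (the_elem (F (x + w)) - the_elem (F x) - f' w) \<le> K * (norm (x - x0) + norm w) * norm w"
proof -
  define f where "f = the_elem \<circ> F"
  obtain U DF K where U: "open U" "x0 \<in> U" "\<forall>x\<in>U. is_singleton (F x)"
    and semi: "semidifferentiable_on f DF U" and K: "0 < K"
    and DF: "\<And>x w. x \<in> U \<Longrightarrow> norm (DF x w - DF x0 w) \<le> K * norm (x - x0) * norm w"
    using sd unfolding lipschitz_semidifferentiable_at_def f_def by auto
  from semi have dir: "\<And>x w. x \<in> U \<Longrightarrow> ((\<lambda>t. (f (x + t *\<^sub>R w) - f x) /\<^sub>R t) \<longlongrightarrow> DF x w) (at_right 0)"
    unfolding semidifferentiable_on_def by auto
  obtain \<rho> where \<rho>: "0 < \<rho>" "ball x0 \<rho> \<subseteq> U" using U open_contains_ball by blast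
  have f': "DF x0 w = f' w" for w
    using has_derivative_imp_right_directional[OF der, of w] dir[OF U(2), of w]
    by (intro tendsto_unique[of "at_right (0::real)"]) (auto simp: f_def)
  have cont: "continuous_on (ball x0 \<rho>) f"
  proof (rule continuous_at_imp_continuous_on, rule ballI)
    fix x assume "x \<in> ball x0 \<rho>"
    then have x: "x \<in> U" using \<rho> by auto
    then obtain e B where e: "0 < e" "B-lipschitz_on (ball x e \<inter> U) f"
      using semi unfolding semidifferentiable_on_def by blast
    have "open (ball x e \<inter> U)" "x \<in> ball x e \<inter> U" using U x e by auto
    then show "isCont f x"
      using lipschitz_on_continuous_on[OF e(2)] continuous_on_eq_continuous_at by blast
  qed
  have "norm (f (x + w) - f x - f' w) \<le> K * (norm (x - x0) + norm w) * norm w"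
    if x: "x \<in> ball x0 \<rho>" "x + w \<in> ball x0 \<rho>" for x w
  proof -
    define h where "h t = f (x + t *\<^sub>R w) - t *\<^sub>R f' w" for t :: real
    have seg: "x + t *\<^sub>R w \<in> ball x0 \<rho>" if "0 \<le> t" "t \<le> 1" for t
    proof -
      have "x + t *\<^sub>R w = (1 - t) *\<^sub>R x + t *\<^sub>R (x + w)" by (simp add: algebra_simps)
      then show ?thesis using convexD_alt[OF convex_ball x] that by simp
    qed
    have "norm (h 1 - h 0) \<le> (K * (norm (x - x0) + norm w) * norm w) * (1 - 0)"
    proof (rule right_derivative_increment_bound)
      have "continuous_on {0..1} (\<lambda>t. f (x + t *\<^sub>R w))"
        by (rule continuous_on_compose2[OF cont]) (auto intro!: continuous_intros seg)
      then show "continuous_on {0..1} h" unfolding h_def by (intro continuous_intros)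
    next
      fix t :: real assume t: "0 \<le> t" "t < 1"
      let ?y = "x + t *\<^sub>R w"
      have y: "?y \<in> U" using seg[of t] t \<rho> by auto
      have "((\<lambda>e. (f (?y + e *\<^sub>R w) - f ?y) /\<^sub>R e - f' w) \<longlongrightarrow> DF ?y w - f' w) (at_right 0)"
        by (intro tendsto_diff dir y tendsto_const)
      moreover have "\<forall>\<^sub>F e in at_right 0. (f (?y + e *\<^sub>R w) - f ?y) /\<^sub>R e - f' w = (h (t + e) - h t) /\<^sub>R e"
        using eventually_at_right_less[of 0]
        by eventually_elim (simp add: h_def algebra_simps)
      ultimately show "((\<lambda>e. (h (t + e) - h t) /\<^sub>R e) \<longlongrightarrow> DF ?y w - f' w) (at_right 0)"
        by (rule Lim_transform_eventually)
      have "norm (?y - x0) \<le> norm (x - x0) + norm (t *\<^sub>R w)"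
        using norm_triangle_ineq[of "x - x0" "t *\<^sub>R w"] by (simp add: algebra_simps)
      also have "norm (t *\<^sub>R w) \<le> norm w" using t by (simp add: mult_left_le_one_le)
      finally have "K * norm (?y - x0) * norm w \<le> K * (norm (x - x0) + norm w) * norm w"
        using K by (intro mult_right_mono mult_left_mono) auto
      then show "norm (DF ?y w - f' w) \<le> K * (norm (x - x0) + norm w) * norm w"
        using DF[OF y, of w] f' by simp
    qed simp
    then show ?thesis by (simp add: h_def algebra_simps)
  qed
  then show thesis
    using \<rho> K U(3) by (intro that[of \<rho> K]) (auto simp: f_def)
qed

lemma zero_with_invertible_derivative:
  fixes f :: "'a::euclidean_space \<Rightarrow> 'b::euclidean_space"
  assumes der: "(f has_derivative f') (at x0)" and inj: "inj f'" and zero: "f x0 = 0"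
  obtains m where "0 < m" and "\<forall>\<^sub>F x in nhds x0. m * norm (x - x0) \<le> norm (f x)"
proof -
  have lin: "linear f'" using der by (rule has_derivative_linear)
  obtain B where B: "0 < B" "\<And>w. B * norm w \<le> norm (f' w)"
    using linear_inj_bounded_below_pos[OF lin inj] by blast
  obtain e where e: "0 < e"
    and small: "\<And>x. norm (x - x0) < e \<Longrightarrow> norm (f x - f x0 - f' (x - x0)) \<le> B / 2 * norm (x - x0)"
    using der B(1) unfolding has_derivative_at_alt by (meson half_gt_zero)
  have "B / 2 * norm (x - x0) \<le> norm (f x)" if "dist x x0 < e" for x
    using small[of x] B(2)[of "x - x0"] that zero norm_triangle_ineq2[of "f' (x - x0)" "f' (x - x0) - f x"]
    by (simp add: dist_norm norm_minus_commute)
  then show thesis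
    using e B by (intro that[of "B / 2"]) (auto simp: eventually_nhds_metric)
qed

section \<open>Runs of the linesearch\<close>

lemma linesearch_run_iterate:
  assumes "linesearch_DRS_run \<phi>1 \<phi>2 \<gamma> relax c \<epsilon> i_max s u v r d \<tau> ls ut vt"
  shows "(u k, v k) \<in> DRS \<gamma> \<phi>1 \<phi>2 (s k)"
proof (cases k)
  case 0
  then show ?thesis using assms by (simp add: linesearch_DRS_run_def)
next
  case (Suc j)
  have "(ut j (ls j), vt j (ls j)) \<in> DRS \<gamma> \<phi>1 \<phi>2 (trial_point relax (s j) (r j) (d j) ((1/2) ^ ls j))"
    using assms unfolding linesearch_DRS_run_def Let_def by blast
  then show ?thesis using assms Suc
    by (auto simp: linesearch_DRS_run_def Let_def split: if_splits dest!: spec[of _ j])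
qed

lemma linesearch_run_first_trial:
  assumes "linesearch_DRS_run \<phi>1 \<phi>2 \<gamma> relax c \<epsilon> i_max s u v r d \<tau> ls ut vt"
  shows "(ut k 0, vt k 0) \<in> DRS \<gamma> \<phi>1 \<phi>2 (s k + d k)"
proof -
  have "\<forall>i\<le>ls k. (ut k i, vt k i) \<in> DRS \<gamma> \<phi>1 \<phi>2 (trial_point relax (s k) (r k) (d k) ((1/2) ^ i))"
    using assms unfolding linesearch_DRS_run_def Let_def by blast
  then have "(ut k 0, vt k 0) \<in> DRS \<gamma> \<phi>1 \<phi>2 (trial_point relax (s k) (r k) (d k) ((1/2) ^ 0))"
    by blast
  then show ?thesis by (simp add: trial_point_def)
qed

lemma linesearch_run_unit_step:
  assumes run: "linesearch_DRS_run \<phi>1 \<phi>2 \<gamma> relax c \<epsilon> i_max s u v r d \<tau> ls ut vt"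
    and ok: "sufficient_decrease \<gamma> \<phi>1 \<phi>2 c (s k) (r k) (s k + d k)"
  shows "\<tau> k = 1 \<and> s (Suc k) = s k + d k"
proof -
  have "ls k = 0"
  proof (rule ccontr)
    assume "ls k \<noteq> 0"
    then have "\<not> sufficient_decrease \<gamma> \<phi>1 \<phi>2 c (s k) (r k) (trial_point relax (s k) (r k) (d k) ((1/2) ^ 0))"
      using run unfolding linesearch_DRS_run_def Let_def by blast
    then show False using ok by (simp add: trial_point_def)
  qed
  then show ?thesis using run ok
    by (auto simp: linesearch_DRS_run_def Let_def trial_point_def dest!: spec[of _ k])
qed

context smooth_prox
begin

text \<open>The decrease holds by the acceptance test, or by \<open>nominal_step_decrease\<close> when the run falls back to
  the relaxed step.\<close>

lemma linesearch_run_decrease: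
  assumes adm: "admissible_params \<phi>1 L \<gamma> relax c"
    and run: "linesearch_DRS_run \<phi>1 \<phi>2 \<gamma> relax c \<epsilon> i_max s u v r d \<tau> ls ut vt"
  shows "sufficient_decrease \<gamma> \<phi>1 \<phi>2 c (s k) (r k) (s (Suc k))"
proof (cases "sufficient_decrease \<gamma> \<phi>1 \<phi>2 c (s k) (r k) (trial_point relax (s k) (r k) (d k) ((1/2) ^ ls k))")
  case True
  then show ?thesis using run by (auto simp: linesearch_DRS_run_def Let_def dest!: spec[of _ k])
next
  case False
  then have "s (Suc k) = s k - relax *\<^sub>R r k"
    using run by (auto simp: linesearch_DRS_run_def Let_def dest!: spec[of _ k])
  moreover have "r k = u k - v k" using run by (simp add: linesearch_DRS_run_def)
  ultimately show ?thesis
    using nominal_step_decrease[OF adm linesearch_run_iterate[OF run, of k], of "u (Suc k)" "v (Suc k)"]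
      linesearch_run_iterate[OF run, of "Suc k"]
    by (simp add: sufficient_decrease_def)
qed

text \<open>The envelope is bounded below by the minimum of the cost and loses at least \<open>c / \<gamma> * (norm (r k))\<^sup>2\<close> in
  each iteration.\<close>

lemma linesearch_run_residuals_square_summable:
  assumes adm: "admissible_params \<phi>1 L \<gamma> relax c"
    and run: "linesearch_DRS_run \<phi>1 \<phi>2 \<gamma> relax c \<epsilon> i_max s u v r d \<tau> ls ut vt"
    and proper: "\<And>x. \<phi>2 x \<noteq> -\<infinity>" "\<phi>2 w \<noteq> \<infinity>"
    and min: "argmin (\<lambda>x. ereal (\<phi>1 x) + \<phi>2 x) \<noteq> {}"
  shows "summable (\<lambda>k. (norm (r k))\<^sup>2)"
proof -
  obtain x0 where x0: "\<And>y. ereal (\<phi>1 x0) + \<phi>2 x0 \<le> ereal (\<phi>1 y) + \<phi>2 y"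
    using min unfolding argmin_iff ex_in_conv[symmetric] by blast
  have "\<phi>2 x0 \<noteq> \<infinity>" using x0[of w] proper by (cases "\<phi>2 w") auto
  then obtain b0 where b0: "\<phi>2 x0 = ereal b0" using proper(1)[of x0] by (cases "\<phi>2 x0") auto
  define e where "e k = real_of_ereal (DRE \<gamma> \<phi>1 \<phi>2 (s k))" for k
  note uv = linesearch_run_iterate[OF run]
  have e: "DRE \<gamma> \<phi>1 \<phi>2 (s k) = ereal (e k)" for k
  proof -
    obtain b where "\<phi>2 (v k) = ereal b" using DRS_finite[OF uv proper] by blast
    then show ?thesis by (simp add: e_def DRE_eq_fb_model[OF uv] fb_model_def)
  qed
  have low: "\<phi>1 x0 + b0 \<le> e k" for k
  proof -
    have "0 \<le> (1 - \<gamma> * L) / (2 * \<gamma>) * (norm (u k - v k))\<^sup>2" using \<gamma>_pos \<gamma>L by simp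
    then have "ereal (\<phi>1 (v k)) + \<phi>2 (v k) \<le>
        ereal (\<phi>1 (v k)) + \<phi>2 (v k) + ereal ((1 - \<gamma> * L) / (2 * \<gamma>) * (norm (u k - v k))\<^sup>2)"
      by (intro ereal_le_add_self) simp
    also have "\<dots> \<le> DRE \<gamma> \<phi>1 \<phi>2 (s k)" by (rule DRE_lower_bound[OF uv])
    finally have "ereal (\<phi>1 (v k)) + \<phi>2 (v k) \<le> ereal (e k)" by (simp only: e)
    with x0[of "v k"] have "ereal (\<phi>1 x0) + \<phi>2 x0 \<le> ereal (e k)" by (rule order_trans)
    then show ?thesis by (simp add: b0)
  qed
  have dec: "e (Suc k) \<le> e k - c / \<gamma> * (norm (r k))\<^sup>2 + 0" for k
    using linesearch_run_decrease[OF adm run, of k] by (simp add: sufficient_decrease_def e)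
  have c: "0 < c" using adm by (simp add: admissible_params_def)
  have "summable (\<lambda>k. c / \<gamma> * (norm (r k))\<^sup>2)"
    by (rule summable_if_telescoping[where a = e and b = "\<lambda>_. 0", OF dec low])
      (use c \<gamma>_pos in simp_all)
  then show ?thesis using c \<gamma>_pos by (simp add: summable_cmult_iff)
qed

text \<open>At a trial point \<open>t k\<close> that is superlinearly closer to \<open>s_star\<close>, the envelope exceeds the locally minimal
  cost \<open>\<phi> us\<close>, \<open>\<phi> = \<phi>1 + \<phi>2\<close>, by only \<open>o((norm (u k - v k))\<^sup>2)\<close>. At \<open>s k\<close> it exceeds the cost at \<open>v k\<close>, hence \<open>\<phi> us\<close>, by
  at least \<open>(1 - \<gamma> * L) / (2 * \<gamma>) * (norm (u k - v k))\<^sup>2\<close>. The gap between \<open>c\<close> and \<open>(1 - \<gamma> * L) / 2\<close> absorbs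
  the small term.\<close>

lemma superlinear_trial_sufficient_decrease:
  assumes c: "c < (1 - \<gamma> * L) / 2"
    and us: "us \<in> prox \<gamma> (\<lambda>x. ereal (\<phi>1 x)) s_star"
    and fin: "\<phi>2 us = ereal b"
    and loc: "\<forall>\<^sub>F y in nhds us. ereal (\<phi>1 us) + \<phi>2 us \<le> ereal (\<phi>1 y) + \<phi>2 y"
    and uv: "\<And>k. (u k, v k) \<in> DRS \<gamma> \<phi>1 \<phi>2 (s k)"
    and uv': "\<And>k. (u' k, v' k) \<in> DRS \<gamma> \<phi>1 \<phi>2 (t k)"
    and s: "s \<longlonglongrightarrow> s_star" and r: "(\<lambda>k. u k - v k) \<longlonglongrightarrow> 0" "\<And>k. u k \<noteq> v k"
    and t: "(\<lambda>k. norm (t k - s_star) / norm (u k - v k)) \<longlonglongrightarrow> 0"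
  shows "\<forall>\<^sub>F k in sequentially. sufficient_decrease \<gamma> \<phi>1 \<phi>2 c (s k) (u k - v k) (t k)"
proof -
  have \<alpha>: "0 < 1 - \<gamma> * L" using \<gamma>L by simp
  have prox_near: "norm (x - us) \<le> norm (y - s_star) / (1 - \<gamma> * L)"
    if "(x, z) \<in> DRS \<gamma> \<phi>1 \<phi>2 y" for x y z
    using prox_lipschitz[OF _ us, of x y] that \<alpha> by (simp add: DRS_def field_simps)
  have "u \<longlonglongrightarrow> us"
  proof (rule Lim_transform_bound[where f = "\<lambda>k. u k - us", THEN LIM_zero_cancel])
    show "\<forall>\<^sub>F k in sequentially. norm (u k - us) \<le> norm (norm (s k - s_star) / (1 - \<gamma> * L))"
      using prox_near[OF uv] \<alpha> by simp
    show "(\<lambda>k. norm (s k - s_star) / (1 - \<gamma> * L)) \<longlonglongrightarrow> 0"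
      using tendsto_divide[OF tendsto_norm[OF LIM_zero[OF s]] tendsto_const[of "1 - \<gamma> * L"]] \<alpha> by simp
  qed
  then have "v \<longlonglongrightarrow> us" using tendsto_diff[OF _ r(1)] by fastforce
  then have v: "\<forall>\<^sub>F k in sequentially. ereal (\<phi>1 us) + \<phi>2 us \<le> ereal (\<phi>1 (v k)) + \<phi>2 (v k)"
    by (rule eventually_compose_filterlim[OF loc])
  define A where "A = (1 + \<gamma> * L) / (2 * \<gamma>)"
  define q where "q k = norm (t k - s_star) / norm (u k - v k) / (1 - \<gamma> * L)" for k
  have A: "0 \<le> A" using \<gamma>_pos L_nonneg by (simp add: A_def)
  have "(\<lambda>k. A * (q k)\<^sup>2) \<longlonglongrightarrow> A * (0 / (1 - \<gamma> * L))\<^sup>2"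
    unfolding q_def by (intro tendsto_intros t) (use \<alpha> in simp)
  moreover have "0 < ((1 - \<gamma> * L) / 2 - c) / \<gamma>" using c \<gamma>_pos by simp
  ultimately have "\<forall>\<^sub>F k in sequentially. A * (q k)\<^sup>2 < ((1 - \<gamma> * L) / 2 - c) / \<gamma>"
    by (simp add: order_tendstoD)
  with v show ?thesis
  proof eventually_elim
    case (elim k)
    let ?n = "(norm (u k - v k))\<^sup>2"
    have "norm (u' k - us) \<le> q k * norm (u k - v k)"
      using prox_near[OF uv'[of k]] r(2)[of k] by (simp add: q_def)
    then have "A * (norm (u' k - us))\<^sup>2 \<le> A * (q k * norm (u k - v k))\<^sup>2"
      using A by (intro mult_left_mono power_mono) auto
    also have "\<dots> = A * (q k)\<^sup>2 * ?n" by (simp add: power_mult_distrib)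
    also have "\<dots> \<le> ((1 - \<gamma> * L) / 2 - c) / \<gamma> * ?n"
      using elim(2) by (intro mult_right_mono) auto
    also have "\<dots> = (1 - \<gamma> * L) / (2 * \<gamma>) * ?n - c / \<gamma> * ?n"
      using \<gamma>_pos by (simp add: field_simps)
    finally have le: "\<phi>1 us + b + A * (norm (u' k - us))\<^sup>2
        \<le> (\<phi>1 us + b + (1 - \<gamma> * L) / (2 * \<gamma>) * ?n) - c / \<gamma> * ?n" by simp
    have "DRE \<gamma> \<phi>1 \<phi>2 (t k) \<le> ereal (\<phi>1 us + b + A * (norm (u' k - us))\<^sup>2)"
      using DRE_upper_bound[OF uv', of k us] by (simp add: fin A_def)
    also have "\<dots> \<le> ereal (\<phi>1 us + b + (1 - \<gamma> * L) / (2 * \<gamma>) * ?n) - ereal (c / \<gamma> * ?n)"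
      using le by simp
    also have "\<dots> \<le> DRE \<gamma> \<phi>1 \<phi>2 (s k) - ereal (c / \<gamma> * ?n)"
    proof (rule ereal_minus_mono)
      have "ereal (\<phi>1 us + b + (1 - \<gamma> * L) / (2 * \<gamma>) * ?n)
          \<le> ereal (\<phi>1 (v k)) + \<phi>2 (v k) + ereal ((1 - \<gamma> * L) / (2 * \<gamma>) * ?n)"
        using elim(1) by (cases "\<phi>2 (v k)") (auto simp: fin)
      also have "\<dots> \<le> DRE \<gamma> \<phi>1 \<phi>2 (s k)" by (rule DRE_lower_bound[OF uv])
      finally show "ereal (\<phi>1 us + b + (1 - \<gamma> * L) / (2 * \<gamma>) * ?n) \<le> DRE \<gamma> \<phi>1 \<phi>2 (s k)" .
    qed simp
    finally show ?case by (simp add: sufficient_decrease_def)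
  qed
qed

end

section \<open>Dennis--More condition and superlinear convergence\<close>

theorem theorem4p8:
  fixes \<phi>1 :: "real^'n \<Rightarrow> real" and \<phi>2 :: "real^'n \<Rightarrow> ereal"
    and L \<gamma> relax c \<theta>_bar :: real and i_max :: enat
    and s u v r d :: "nat \<Rightarrow> real^'n" and \<tau> :: "nat \<Rightarrow> real"
    and ls :: "nat \<Rightarrow> nat" and ut vt :: "nat \<Rightarrow> nat \<Rightarrow> real^'n"
    and H0 :: "real^'n^'n" and H :: "nat \<Rightarrow> real^'n^'n" and s_star :: "real^'n"
  assumes "lipschitz_gradient L \<phi>1"
    and "\<forall>x. \<phi>2 x \<noteq> -\<infinity>" and "lsc \<phi>2"
    and "argmin (\<lambda>x. ereal (\<phi>1 x) + \<phi>2 x) \<noteq> {}"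
    and "admissible_params \<phi>1 L \<gamma> relax c"
    and "linesearch_DRS_run \<phi>1 \<phi>2 \<gamma> relax c 0 i_max s u v r d \<tau> ls ut vt"
    and "0 < \<theta>_bar" and "\<theta>_bar < 1" and "invertible H0"
    and "modified_broyden \<theta>_bar H0 H r (\<lambda>k. ut k 0 - vt k 0) d"
    and "bounded (range H)"
    and "s \<longlonglongrightarrow> s_star"
    and "strong_local_min (\<lambda>x. ereal (\<phi>1 x) + \<phi>2 x)
           (the_elem (prox \<gamma> (\<lambda>x. ereal (\<phi>1 x)) s_star))"
    and "lipschitz_semidifferentiable_at (residual \<gamma> \<phi>1 \<phi>2) s_star"
    and "(the_elem \<circ> residual \<gamma> \<phi>1 \<phi>2) differentiable (at s_star)"
    and "invertible (jacobian (the_elem \<circ> residual \<gamma> \<phi>1 \<phi>2) (at s_star))"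
  shows "(\<lambda>k. norm (the_elem (residual \<gamma> \<phi>1 \<phi>2 (s k))
           + jacobian (the_elem \<circ> residual \<gamma> \<phi>1 \<phi>2) (at s_star) *v d k) / norm (d k)) \<longlonglongrightarrow> 0 \<and>
    (\<forall>\<^sub>F k in sequentially. \<tau> k = 1 \<and> s (Suc k) = s k + d k \<and>
       sufficient_decrease \<gamma> \<phi>1 \<phi>2 c (s k) (r k) (s k + d k)) \<and>
    superlinear_conv s s_star"
proof -
  note adm = assms(5) and run = assms(6) and \<theta>_bar = assms(7,8) and broyden = assms(10,9)
    and s = assms(12)
  obtain grad where grad: "\<And>x. GDERIV \<phi>1 x :> grad x" and lip: "L-lipschitz_on UNIV grad"
    using assms(1) by (auto simp: lipschitz_gradient_def)
  have relax: "0 < relax" and \<gamma>: "0 < \<gamma>" and cC: "c < C_const \<phi>1 (\<gamma> * L) relax"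
    using adm by (simp_all add: admissible_params_def)
  have "\<gamma> * L < 1"
    using adm by (auto simp: admissible_params_def split: if_splits)
  then interpret smooth_prox \<phi>1 grad L \<gamma>
    using grad lip \<gamma> by unfold_locales
  have c: "c < (1 - \<gamma> * L) / 2"
    using cC C_const_le_half[of "\<gamma> * L" relax \<phi>1] \<gamma>_pos L_nonneg \<gamma>L relax by simp
  define R where "R = the_elem \<circ> residual \<gamma> \<phi>1 \<phi>2"
  define J where "J = jacobian R (at s_star)"
  define r0 where "r0 k = ut k 0 - vt k 0" for k
  define y where "y k = r0 k - r k - J *v d k" for k
  note uv = linesearch_run_iterate[OF run] and uv0 = linesearch_run_first_trial[OF run]
  have r: "r k = u k - v k" and "\<not> 1 / \<gamma> * norm (r k) \<le> 0" for k
    using run unfolding linesearch_DRS_run_def by blast+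
  then have r_nz: "r k \<noteq> 0" for k by (metis mult_zero_right norm_zero order_refl)
  have der: "(R has_derivative (\<lambda>w. J *v w)) (at s_star)"
    using assms(15) unfolding R_def J_def by (simp add: jacobian_works)
  obtain \<rho> K where \<rho>: "0 < \<rho>" and K: "0 < K"
    and single: "\<And>x. x \<in> ball s_star \<rho> \<Longrightarrow> is_singleton (residual \<gamma> \<phi>1 \<phi>2 x)"
    and strict: "\<And>x w. x \<in> ball s_star \<rho> \<Longrightarrow> x + w \<in> ball s_star \<rho> \<Longrightarrow>
      norm (R (x + w) - R x - J *v w) \<le> K * (norm (x - s_star) + norm w) * norm w"
    using strict_differentiability_estimate[OF assms(14) der[unfolded R_def]] unfolding R_def by auto
  have R_eq: "R z = a - b" if "z \<in> ball s_star \<rho>" "(a, b) \<in> DRS \<gamma> \<phi>1 \<phi>2 z" for a b z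
  proof -
    have "a - b \<in> residual \<gamma> \<phi>1 \<phi>2 z" using that(2) by (auto simp: residual_def)
    then have "residual \<gamma> \<phi>1 \<phi>2 z = {a - b}" using single[OF that(1)] by (auto elim!: is_singletonE)
    then show ?thesis by (simp add: R_def)
  qed

  obtain us vs where us_vs: "(us, vs) \<in> DRS \<gamma> \<phi>1 \<phi>2 s_star"
    using single[of s_star] \<rho> by (auto simp: residual_def elim!: is_singletonE)
  then have us: "us \<in> prox \<gamma> (\<lambda>x. ereal (\<phi>1 x)) s_star" by (simp add: DRS_def)
  then have "prox \<gamma> (\<lambda>x. ereal (\<phi>1 x)) s_star = {us}" using prox_unique by auto
  with assms(13) obtain \<mu> where \<mu>: "0 < \<mu>" and fin: "\<bar>ereal (\<phi>1 us) + \<phi>2 us\<bar> \<noteq> \<infinity>"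
    and growth: "\<forall>\<^sub>F x in nhds us.
      ereal (\<phi>1 us) + \<phi>2 us + ereal (\<mu> / 2 * (norm (x - us))\<^sup>2) \<le> ereal (\<phi>1 x) + \<phi>2 x"
    by (auto simp: strong_local_min_def)
  obtain b where b: "\<phi>2 us = ereal b" using fin by (cases "\<phi>2 us") auto
  have loc: "\<forall>\<^sub>F x in nhds us. ereal (\<phi>1 us) + \<phi>2 us \<le> ereal (\<phi>1 x) + \<phi>2 x"
    using growth
  proof eventually_elim
    case (elim x)
    have "ereal (\<phi>1 us) + \<phi>2 us \<le> ereal (\<phi>1 us) + \<phi>2 us + ereal (\<mu> / 2 * (norm (x - us))\<^sup>2)"
      using \<mu> by (intro ereal_le_add_self) simp
    then show ?case using elim by (rule order_trans)
  qed

  have sq: "summable (\<lambda>k. (norm (r k))\<^sup>2)"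
    by (rule linesearch_run_residuals_square_summable[OF adm run, where w = us])
      (use assms(2,4) b in auto)
  then have r_lim: "r \<longlonglongrightarrow> 0"
    using summable_LIMSEQ_zero[OF sq] by (simp add: tendsto_norm_zero_iff)
  have ball_ev: "\<forall>\<^sub>F k in sequentially. x k \<in> ball s_star \<rho>" if "x \<longlonglongrightarrow> s_star" for x
    using topological_tendstoD[OF that open_ball] \<rho> by simp
  have Rs: "\<forall>\<^sub>F k in sequentially. R (s k) = r k"
    using ball_ev[OF s] by eventually_elim (auto simp: r intro: R_eq uv)
  have R_star: "R s_star = 0"
  proof (rule LIMSEQ_unique)
    show "(\<lambda>k. R (s k)) \<longlonglongrightarrow> R s_star"
      using isCont_tendsto_compose[OF has_derivative_continuous[OF der] s] .
    show "(\<lambda>k. R (s k)) \<longlonglongrightarrow> 0"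
      by (rule Lim_transform_eventually[OF r_lim]) (use Rs in \<open>auto elim: eventually_mono\<close>)
  qed
  have "inj ((*v) J)" using assms(16) unfolding J_def R_def by (simp add: invertible_left_inverse inj_matrix_vector_mult)
  then obtain m where m: "0 < m" and error: "\<forall>\<^sub>F x in nhds s_star. m * norm (x - s_star) \<le> norm (R x)"
    using zero_with_invertible_derivative[OF der _ R_star] by blast

  obtain B where B: "0 < B" "\<And>k. norm (H k) \<le> B"
    using assms(11) by (auto simp: bounded_pos)
  have d_le: "norm (d k) \<le> B * norm (r k)" for k
  proof -
    have "norm (d k) = norm (H k *v r k)" using broyden(1) by (simp add: modified_broyden_def)
    also have "\<dots> \<le> norm (H k) * norm (r k)" by (rule norm_matrix_vector_mult_le)
    also have "\<dots> \<le> B * norm (r k)" by (intro mult_right_mono B) simp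
    finally show ?thesis .
  qed
  have "(\<lambda>k. B * norm (r k)) \<longlonglongrightarrow> 0"
    using tendsto_mult[OF tendsto_const tendsto_norm_zero[OF r_lim], of B] by simp
  then have "d \<longlonglongrightarrow> 0"
    by (rule tendsto_0_le[where K = 1]) (use d_le B in \<open>auto simp: abs_mult\<close>)
  then have sd: "(\<lambda>k. s k + d k) \<longlonglongrightarrow> s_star" using tendsto_add[OF s] by fastforce
  have Rsd: "\<forall>\<^sub>F k in sequentially. R (s k + d k) = r0 k"
    using ball_ev[OF sd] by eventually_elim (auto simp: r0_def intro: R_eq uv0)

  \<comment> \<open>The factor \<open>1 / m\<close> converts the distance to \<open>s_star\<close> into the residual, and \<open>B\<close> converts the direction.\<close>
  define K' where "K' = K * (1 / m + B)"
  have K': "0 < K'" using K m B by (simp add: K'_def add_pos_pos)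
  have y_le: "\<forall>\<^sub>F k in sequentially. norm (y k) \<le> K' * norm (r k) * norm (d k)"
    using ball_ev[OF s] ball_ev[OF sd] Rs Rsd eventually_compose_filterlim[OF error s]
  proof eventually_elim
    case (elim k)
    have "norm (s k - s_star) \<le> 1 / m * norm (r k)" using elim m by (simp add: field_simps)
    then have "K * (norm (s k - s_star) + norm (d k)) * norm (d k)
        \<le> K * (1 / m * norm (r k) + B * norm (r k)) * norm (d k)"
      using d_le[of k] K by (intro mult_right_mono mult_left_mono add_mono) auto
    also have "\<dots> = K' * norm (r k) * norm (d k)" by (simp add: K'_def algebra_simps)
    finally show ?case using strict[OF elim(1,2)] elim(3,4) by (simp add: y_def)
  qed
  have "summable (\<lambda>k. (norm (y k) / norm (d k))\<^sup>2)"
  proof (rule summable_comparison_test_ev)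
    show "summable (\<lambda>k. K'\<^sup>2 * (norm (r k))\<^sup>2)" by (rule summable_mult[OF sq])
    show "\<forall>\<^sub>F k in sequentially. norm ((norm (y k) / norm (d k))\<^sup>2) \<le> K'\<^sup>2 * (norm (r k))\<^sup>2"
      using y_le
    proof eventually_elim
      case (elim k)
      then have "norm (y k) / norm (d k) \<le> K' * norm (r k)"
        using K' by (cases "d k = 0") (auto simp: divide_le_eq)
      then have "(norm (y k) / norm (d k))\<^sup>2 \<le> (K' * norm (r k))\<^sup>2" by (intro power_mono) auto
      then show ?case by (simp add: power_mult_distrib)
    qed
  qed
  then have dm: "(\<lambda>k. norm (r k + J *v d k) / norm (d k)) \<longlonglongrightarrow> 0"
    using modified_broyden_dennis_more[OF broyden \<theta>_bar r_nz, of J] by (simp add: y_def r0_def)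
  have d_nz: "d k \<noteq> 0" for k
    using modified_broyden_invertible[OF broyden \<theta>_bar r_nz] by blast
  have dm': "(\<lambda>k. norm (the_elem (residual \<gamma> \<phi>1 \<phi>2 (s k)) + J *v d k) / norm (d k)) \<longlonglongrightarrow> 0"
    by (rule Lim_transform_eventually[OF dm]) (use Rs in \<open>auto simp: R_def elim: eventually_mono\<close>)

  \<comment> \<open>The superlinear rate: \<open>r0 k\<close> is \<open>(r k + J *v d k) + y k\<close>, both parts are small relative to \<open>d k\<close>, and
    the error bound with factor \<open>m\<close> passes from the residual \<open>r0 k\<close> at the trial point to its distance from \<open>s_star\<close>.\<close>
  define \<kappa> where "\<kappa> k = B * (norm (r k + J *v d k) / norm (d k) + K' * norm (r k)) / m" for k
  have \<kappa>: "\<kappa> \<longlonglongrightarrow> 0"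
  proof -
    have "\<kappa> \<longlonglongrightarrow> B * (0 + K' * norm (0 :: real^'n)) / m"
      unfolding \<kappa>_def by (intro tendsto_intros dm r_lim) (use m in auto)
    then show ?thesis by simp
  qed
  have trial: "\<forall>\<^sub>F k in sequentially. norm (s k + d k - s_star) \<le> \<kappa> k * norm (r k)"
    using y_le Rsd eventually_compose_filterlim[OF error sd]
  proof eventually_elim
    case (elim k)
    let ?e = "norm (r k + J *v d k) / norm (d k)"
    have "r0 k = (r k + J *v d k) + y k" by (simp add: y_def)
    then have "norm (r0 k) \<le> norm (r k + J *v d k) + norm (y k)" by (metis norm_triangle_ineq)
    also have "\<dots> \<le> (?e + K' * norm (r k)) * norm (d k)"
      using elim(1) d_nz[of k] by (simp add: distrib_right)
    also have "\<dots> \<le> (?e + K' * norm (r k)) * (B * norm (r k))"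
      using d_le K' by (intro mult_left_mono) auto
    also have "\<dots> = m * (\<kappa> k * norm (r k))" using m by (simp add: \<kappa>_def)
    finally have "m * norm (s k + d k - s_star) \<le> m * (\<kappa> k * norm (r k))"
      using elim(2,3) by simp
    then show ?case using m by (simp only: mult_le_cancel_left_pos)
  qed

  have "\<forall>\<^sub>F k in sequentially. sufficient_decrease \<gamma> \<phi>1 \<phi>2 c (s k) (u k - v k) (s k + d k)"
  proof (rule superlinear_trial_sufficient_decrease[OF c us b loc uv uv0 s])
    show "(\<lambda>k. u k - v k) \<longlonglongrightarrow> 0" "u k \<noteq> v k" for k
      using r_lim r_nz[of k] by (simp_all add: r[abs_def])
    show "(\<lambda>k. norm (s k + d k - s_star) / norm (u k - v k)) \<longlonglongrightarrow> 0"
    proof (rule tendsto_0_le[OF \<kappa>, of _ 1])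
      show "\<forall>\<^sub>F k in sequentially. norm (norm (s k + d k - s_star) / norm (u k - v k)) \<le> norm (\<kappa> k) * 1"
        using trial
      proof eventually_elim
        case (elim k)
        then have "norm (s k + d k - s_star) / norm (r k) \<le> \<kappa> k"
          using r_nz[of k] by (simp add: divide_le_eq)
        then show ?case by (simp add: r)
      qed
    qed
  qed
  then have unit: "\<forall>\<^sub>F k in sequentially. \<tau> k = 1 \<and> s (Suc k) = s k + d k \<and>
       sufficient_decrease \<gamma> \<phi>1 \<phi>2 c (s k) (r k) (s k + d k)"
    by eventually_elim (use linesearch_run_unit_step[OF run] in \<open>auto simp: r\<close>)

  \<comment> \<open>\<open>R\<close> is Lipschitz at its zero \<open>s_star\<close> with constant \<open>norm J + K * \<rho>\<close>, so the rate relative to \<open>r k\<close> is one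
    relative to the distance from \<open>s_star\<close>.\<close>
  have "(\<lambda>k. norm (s (Suc k) - s_star) / norm (s k - s_star)) \<longlonglongrightarrow> 0"
  proof (rule tendsto_0_le[OF \<kappa>, of _ "norm J + K * \<rho>"])
    show "\<forall>\<^sub>F k in sequentially. norm (norm (s (Suc k) - s_star) / norm (s k - s_star))
        \<le> norm (\<kappa> k) * (norm J + K * \<rho>)"
      using trial unit ball_ev[OF s] Rs
    proof eventually_elim
      case (elim k)
      let ?w = "s k - s_star"
      have w: "?w \<noteq> 0" using elim(4) R_star r_nz[of k] by auto
      have wr: "norm ?w \<le> \<rho>" using elim(3) by (simp add: dist_norm norm_minus_commute)
      have "norm (r k - J *v ?w) \<le> K * norm ?w * norm ?w"
        using strict[of s_star ?w] \<rho> elim(3,4) R_star by simp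
      also have "\<dots> \<le> K * \<rho> * norm ?w"
        using K wr by (intro mult_right_mono mult_left_mono) auto
      finally have "norm (r k) \<le> (norm J + K * \<rho>) * norm ?w"
        using norm_triangle_ineq[of "J *v ?w" "r k - J *v ?w"] norm_matrix_vector_mult_le[of J ?w]
        by (simp add: distrib_right)
      then have "\<kappa> k * norm (r k) \<le> \<kappa> k * ((norm J + K * \<rho>) * norm ?w)"
        using B m K' by (intro mult_left_mono) (auto simp: \<kappa>_def)
      then have "norm (s (Suc k) - s_star) \<le> \<kappa> k * (norm J + K * \<rho>) * norm ?w"
        using elim(1,2) by (simp add: mult.assoc)
      then have "norm (s (Suc k) - s_star) / norm ?w \<le> \<kappa> k * (norm J + K * \<rho>)"
        using w by (simp add: divide_le_eq)
      also have "\<dots> \<le> norm (\<kappa> k) * (norm J + K * \<rho>)"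
        using K \<rho> by (intro mult_right_mono) auto
      finally show ?case by simp
    qed
  qed
  then have "superlinear_conv s s_star" by (simp add: superlinear_conv_def)
  with dm' unit show ?thesis by (simp add: J_def R_def)
qed

end
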